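(* Let $A_\Gamma$ be an Artin group such that there exists a prime $p$ with $p\mid \frac{l(e)}{2}$ for every edge $e$ of $\Gamma$ with even label $l(e)>2$. Then for every nonzero character $\chi:A_\Gamma\to\mathbb{R}$, $[\chi]\in\Sigma^1(A_\Gamma,\mathbb{Z})$ if and only if $\mathrm{Liv}^\chi$ is connected and dominant.
   Context: $\Gamma$ is a finite simple graph with edge labels $l(e)\in\mathbb{Z}_{\ge2}$; $A_\Gamma=\langle V(\Gamma)\mid \langle u,v\rangle^{l(e)}=\langle v,u\rangle^{l(e)}\ \forall e=\{u,v\}\in E(\Gamma)\rangle$, $\langle u,v\rangle^m$ the alternating word $uvu\cdots$ of length $m$. A character is a homomorphism $\chi:A_\Gamma\to\mathbb{R}$, $[\chi]$ its class up to positive scaling. $\Sigma^1(G,\mathbb{Z})=\{[\chi]\mid\mathbb{Z}\text{ is of type }FP_1\text{ over }\mathbb{Z}G_\chi\}$ with $G_\chi=\{g\mid\chi(g)\ge0\}$. A vertex $v$ is dead if $\chi(v)=0$; an edge $e=\{u,v\}$ is dead if $l(e)>2$ is even and $\chi(u)+\chi(v)=0$. The living subgraph $\mathrm{Liv}^\chi$ is obtained from $\Gamma$ by removing all dead vertices (with incident edges) and the interiors of all dead edges. It is dominant if every vertex of $\Gamma$ not in $\mathrm{Liv}^\chi$ is adjacent in $\Gamma$ to some vertex of $\mathrm{Liv}^\chi$. *)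

theory Defs
  imports Complex_Main "HOL-Algebra.Group" "HOL-Computational_Algebra.Primes"
begin

definition labelled_graph :: "'v set \<Rightarrow> ('v \<Rightarrow> 'v \<Rightarrow> bool) \<Rightarrow> ('v \<Rightarrow> 'v \<Rightarrow> nat) \<Rightarrow> bool" where
  "labelled_graph V E lab \<longleftrightarrow> finite V \<and>
     (\<forall>u v. E u v \<longrightarrow> u \<in> V \<and> v \<in> V \<and> u \<noteq> v \<and> E v u \<and> lab u v = lab v u \<and> lab u v \<ge> 2)"

text \<open>Letters: (v, False) is the generator v, (v, True) its inverse.\<close>
definition alt_word :: "'v \<Rightarrow> 'v \<Rightarrow> nat \<Rightarrow> ('v \<times> bool) list" where
  "alt_word u v m = map (\<lambda>i. if even i then (u, False) else (v, False)) [0..<m]"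

inductive artin_rel :: "('v \<Rightarrow> 'v \<Rightarrow> bool) \<Rightarrow> ('v \<Rightarrow> 'v \<Rightarrow> nat) \<Rightarrow> ('v \<times> bool) list \<Rightarrow> ('v \<times> bool) list \<Rightarrow> bool"
  for E lab where
  ar_refl: "artin_rel E lab w w"
| ar_sym: "artin_rel E lab w w' \<Longrightarrow> artin_rel E lab w' w"
| ar_trans: "artin_rel E lab w w' \<Longrightarrow> artin_rel E lab w' w'' \<Longrightarrow> artin_rel E lab w w''"
| ar_cong: "artin_rel E lab w w' \<Longrightarrow> artin_rel E lab (a @ w @ b) (a @ w' @ b)"
| ar_cancel: "artin_rel E lab [(v, b), (v, \<not> b)] []"
| ar_braid: "E u v \<Longrightarrow> artin_rel E lab (alt_word u v (lab u v)) (alt_word v u (lab u v))"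

definition artin_class :: "('v \<Rightarrow> 'v \<Rightarrow> bool) \<Rightarrow> ('v \<Rightarrow> 'v \<Rightarrow> nat) \<Rightarrow> ('v \<times> bool) list \<Rightarrow> ('v \<times> bool) list set" where
  "artin_class E lab w = {w'. artin_rel E lab w w'}"

definition artin_group :: "'v set \<Rightarrow> ('v \<Rightarrow> 'v \<Rightarrow> bool) \<Rightarrow> ('v \<Rightarrow> 'v \<Rightarrow> nat) \<Rightarrow> ('v \<times> bool) list set monoid" where
  "artin_group V E lab =
     \<lparr> carrier = artin_class E lab ` lists (V \<times> UNIV),
       monoid.mult = (\<lambda>X Y. {w. \<exists>x\<in>X. \<exists>y\<in>Y. artin_rel E lab (x @ y) w}),
       one = artin_class E lab [] \<rparr>"

definition artin_gen :: "('v \<Rightarrow> 'v \<Rightarrow> bool) \<Rightarrow> ('v \<Rightarrow> 'v \<Rightarrow> nat) \<Rightarrow> 'v \<Rightarrow> ('v \<times> bool) list set" where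
  "artin_gen E lab v = artin_class E lab [(v, False)]"

definition character :: "('g, 'b) monoid_scheme \<Rightarrow> ('g \<Rightarrow> real) \<Rightarrow> bool" where
  "character G \<chi> \<longleftrightarrow> (\<forall>x\<in>carrier G. \<forall>y\<in>carrier G. \<chi> (x \<otimes>\<^bsub>G\<^esub> y) = \<chi> x + \<chi> y)"

text \<open>Elements of the monoid ring Z M (M a submonoid of G): finitely supported integer functions supported in M.\<close>
definition mr_elem :: "'g set \<Rightarrow> ('g \<Rightarrow> int) \<Rightarrow> bool" where
  "mr_elem M f \<longleftrightarrow> finite {x. f x \<noteq> 0} \<and> {x. f x \<noteq> 0} \<subseteq> M"

definition mr_mult :: "('g, 'b) monoid_scheme \<Rightarrow> ('g \<Rightarrow> int) \<Rightarrow> ('g \<Rightarrow> int) \<Rightarrow> 'g \<Rightarrow> int" where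
  "mr_mult G f h = (\<lambda>g. \<Sum>(a, b)\<in>{(a, b). f a \<noteq> 0 \<and> h b \<noteq> 0 \<and> a \<otimes>\<^bsub>G\<^esub> b = g}. f a * h b)"

definition mr_aug :: "('g \<Rightarrow> int) \<Rightarrow> int" where
  "mr_aug f = (\<Sum>g\<in>{x. f x \<noteq> 0}. f g)"

text \<open>The trivial module Z is of type FP_1 over Z M: there is an exact sequence
  F_1 \<rightarrow> F_0 \<rightarrow> Z \<rightarrow> 0 of left Z M-modules with F_1 = (Z M)^n1, F_0 = (Z M)^n0 finitely
  generated free.  A Z M-linear map F_1 \<rightarrow> F_0 is given by a matrix D (y \<mapsto> y D), and a
  Z M-linear map F_0 \<rightarrow> Z (trivial action) by integers c_j (x \<mapsto> sum_j aug(x_j) c_j).\<close>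
definition FP1_over :: "('g, 'b) monoid_scheme \<Rightarrow> 'g set \<Rightarrow> bool" where
  "FP1_over G M \<longleftrightarrow>
    (\<exists>(n0::nat) (n1::nat) (D::nat \<Rightarrow> nat \<Rightarrow> 'g \<Rightarrow> int) (c::nat \<Rightarrow> int).
      (\<forall>i<n1. \<forall>j<n0. mr_elem M (D i j)) \<and>
      (\<forall>z::int. \<exists>x. (\<forall>j<n0. mr_elem M (x j)) \<and> (\<Sum>j<n0. mr_aug (x j) * c j) = z) \<and>
      (\<forall>x. (\<forall>j<n0. mr_elem M (x j)) \<longrightarrow>
          ((\<Sum>j<n0. mr_aug (x j) * c j) = 0 \<longleftrightarrow>
           (\<exists>y. (\<forall>i<n1. mr_elem M (y i)) \<and>
                (\<forall>j<n0. x j = (\<lambda>g. \<Sum>i<n1. mr_mult G (y i) (D i j) g))))))"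

text \<open>[chi] \<in> Sigma^1(G, Z): Z is of type FP_1 over Z G_chi, G_chi = {g. chi g \<ge> 0}.
  (This only depends on chi up to positive scaling.)\<close>
definition in_Sigma1 :: "('g, 'b) monoid_scheme \<Rightarrow> ('g \<Rightarrow> real) \<Rightarrow> bool" where
  "in_Sigma1 G \<chi> \<longleftrightarrow> FP1_over G {g \<in> carrier G. \<chi> g \<ge> 0}"

definition live_vertex :: "'v set \<Rightarrow> ('v \<Rightarrow> 'v \<Rightarrow> bool) \<Rightarrow> ('v \<Rightarrow> 'v \<Rightarrow> nat) \<Rightarrow> (('v \<times> bool) list set \<Rightarrow> real) \<Rightarrow> 'v \<Rightarrow> bool" where
  "live_vertex V E lab \<chi> v \<longleftrightarrow> v \<in> V \<and> \<chi> (artin_gen E lab v) \<noteq> 0"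

definition dead_edge :: "('v \<Rightarrow> 'v \<Rightarrow> bool) \<Rightarrow> ('v \<Rightarrow> 'v \<Rightarrow> nat) \<Rightarrow> (('v \<times> bool) list set \<Rightarrow> real) \<Rightarrow> 'v \<Rightarrow> 'v \<Rightarrow> bool" where
  "dead_edge E lab \<chi> u v \<longleftrightarrow> E u v \<and> even (lab u v) \<and> lab u v > 2 \<and>
     \<chi> (artin_gen E lab u) + \<chi> (artin_gen E lab v) = 0"

definition live_edge :: "'v set \<Rightarrow> ('v \<Rightarrow> 'v \<Rightarrow> bool) \<Rightarrow> ('v \<Rightarrow> 'v \<Rightarrow> nat) \<Rightarrow> (('v \<times> bool) list set \<Rightarrow> real) \<Rightarrow> 'v \<Rightarrow> 'v \<Rightarrow> bool" where
  "live_edge V E lab \<chi> u v \<longleftrightarrow> E u v \<and> live_vertex V E lab \<chi> u \<and> live_vertex V E lab \<chi> v \<and>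
     \<not> dead_edge E lab \<chi> u v"

definition liv_connected :: "'v set \<Rightarrow> ('v \<Rightarrow> 'v \<Rightarrow> bool) \<Rightarrow> ('v \<Rightarrow> 'v \<Rightarrow> nat) \<Rightarrow> (('v \<times> bool) list set \<Rightarrow> real) \<Rightarrow> bool" where
  "liv_connected V E lab \<chi> \<longleftrightarrow> (\<exists>v. live_vertex V E lab \<chi> v) \<and>
     (\<forall>u v. live_vertex V E lab \<chi> u \<and> live_vertex V E lab \<chi> v \<longrightarrow> (live_edge V E lab \<chi>)\<^sup>*\<^sup>* u v)"

definition liv_dominant :: "'v set \<Rightarrow> ('v \<Rightarrow> 'v \<Rightarrow> bool) \<Rightarrow> ('v \<Rightarrow> 'v \<Rightarrow> nat) \<Rightarrow> (('v \<times> bool) list set \<Rightarrow> real) \<Rightarrow> bool" where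
  "liv_dominant V E lab \<chi> \<longleftrightarrow>
     (\<forall>v\<in>V. \<not> live_vertex V E lab \<chi> v \<longrightarrow> (\<exists>u. live_vertex V E lab \<chi> u \<and> E v u))"

end

theory Submission
  imports Defs "HOL-Algebra.Generated_Groups" "HOL-Algebra.Group_Action"
begin

text \<open>
  Being of type FP_1 over the monoid ring of \<open>M = G\<^sub>\<chi>\<close> means that the Cayley graph of \<open>M\<close> with
  respect to some finite subset of \<open>M\<close> is connected.

  If the living subgraph is connected and dominant, the living generators together with the squared
  Garside elements of the dihedral subgroups on which \<open>\<chi>\<close> does not vanish form a connected
  commuting graph, and every generator commutes with one of them. Commutation squares far out then
  connect everything inside \<open>M\<close>.

  Conversely, let \<open>G\<close> act on a bundle over the real line, covering the translations by \<open>\<chi>\<close>, such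
  that every element preserves a section \<open>\<sigma>\<close> far to the left. Connectedness makes "far to the left"
  uniform over \<open>M\<close>; conjugating by powers of an element that moves the line and preserves all of
  \<open>\<sigma>\<close> then shows that all of \<open>G\<close> preserves \<open>\<sigma>\<close>. Violating actions arise from an action on a
  trivial bundle that preserves the zero section, by conjugating some of the generators by a gauge
  transformation supported over \<open>0\<close>. If the living subgraph is disconnected, start from the
  translations of a complex line bundle and conjugate the generators of one component by a gauge
  transformation of order \<open>p\<close>; the relations of the dead edges survive because \<open>p\<close> divides half
  their labels. If a dead vertex has only dead neighbours, take the reflection representation of the
  Coxeter group as fibre and conjugate this vertex alone by a translation in its own coordinate,
  which commutes with all other reflections. (An abelian action on the fibre does not suffice here
  when dead vertices are joined by edges with odd labels.)
\<close>

section \<open>Monoid rings\<close>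

definition mr_single :: "'g \<Rightarrow> 'g \<Rightarrow> int" where
  "mr_single a = (\<lambda>g. of_bool (g = a))"

definition mr_extend :: "('g \<Rightarrow> int) \<Rightarrow> ('g \<Rightarrow> int) \<Rightarrow> int" where
  "mr_extend \<phi> f = (\<Sum>g | f g \<noteq> 0. \<phi> g * f g)"

lemma mr_elemI: "{x. f x \<noteq> 0} \<subseteq> A \<Longrightarrow> finite A \<Longrightarrow> A \<subseteq> M \<Longrightarrow> mr_elem M f"
  unfolding mr_elem_def by (blast intro: finite_subset)

lemma mr_elem_zero: "mr_elem M (\<lambda>g. 0)"
  by (simp add: mr_elem_def)

lemma mr_elem_single: "a \<in> M \<Longrightarrow> mr_elem M (mr_single a)"
  by (rule mr_elemI[of _ "{a}"]) (auto simp: mr_single_def)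

lemma mr_elem_add_scale:
  assumes "mr_elem M f" "mr_elem M h"
  shows "mr_elem M (\<lambda>g. f g + k * h g)"
  by (rule mr_elemI[of _ "{x. f x \<noteq> 0} \<union> {x. h x \<noteq> 0}"]) (use assms in \<open>auto simp: mr_elem_def\<close>)

lemma mr_elem_sum:
  assumes "\<And>i. i \<in> I \<Longrightarrow> mr_elem M (f i)"
  shows "mr_elem M (\<lambda>g. \<Sum>i\<in>I. f i g)"
  using assms
proof (induction I rule: infinite_finite_induct)
  case (insert i I)
  then show ?case
    using mr_elem_add_scale[of M "f i" "\<lambda>g. \<Sum>i\<in>I. f i g" 1] by simp
qed (simp_all add: mr_elem_zero)

lemma mr_extend_eq_sum:
  assumes "finite A" "{g. f g \<noteq> 0} \<subseteq> A"
  shows "mr_extend \<phi> f = (\<Sum>g\<in>A. \<phi> g * f g)"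
  unfolding mr_extend_def by (rule sum.mono_neutral_left) (use assms in auto)

lemma mr_aug_eq_extend: "mr_aug f = mr_extend (\<lambda>_. 1) f"
  by (simp add: mr_aug_def mr_extend_def)

lemma mr_extend_single [simp]: "mr_extend \<phi> (mr_single a) = \<phi> a"
  by (subst mr_extend_eq_sum[of "{a}"]) (auto simp: mr_single_def)

lemma mr_extend_by_single:
  assumes "mr_elem M f"
  shows "mr_extend (mr_single g) f = f g"
proof -
  have "mr_extend (mr_single g) f = (\<Sum>x | f x \<noteq> 0. if x = g then f x else 0)"
    unfolding mr_extend_def by (rule sum.cong) (auto simp: mr_single_def)
  then show ?thesis
    using assms by (simp add: mr_elem_def)
qed

lemma mr_extend_cong:
  assumes "mr_elem M f" "\<And>g. g \<in> M \<Longrightarrow> \<phi> g = \<psi> g"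
  shows "mr_extend \<phi> f = mr_extend \<psi> f"
  unfolding mr_extend_def by (rule sum.cong) (use assms in \<open>auto simp: mr_elem_def\<close>)

lemma mr_extend_0 [simp]: "mr_extend (\<lambda>g. 0) f = 0" "mr_extend \<phi> (\<lambda>g. 0) = 0"
  by (simp_all add: mr_extend_def)

lemma mr_extend_mult_const: "mr_extend (\<lambda>g. \<phi> g * k) f = mr_extend \<phi> f * k"
  by (simp add: mr_extend_def sum_distrib_left mult_ac)

lemma mr_extend_add_scale:
  assumes "mr_elem M f" "mr_elem M h"
  shows "mr_extend \<phi> (\<lambda>g. f g + k * h g) = mr_extend \<phi> f + k * mr_extend \<phi> h"
proof -
  define A where "A = {x. f x \<noteq> 0} \<union> {x. h x \<noteq> 0}"
  have "finite A"
    using assms by (simp add: A_def mr_elem_def)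
  then have extend: "mr_extend \<phi> u = (\<Sum>g\<in>A. \<phi> g * u g)" if "{g. u g \<noteq> 0} \<subseteq> A" for u
    using that by (rule mr_extend_eq_sum)
  have "{g. f g + k * h g \<noteq> 0} \<subseteq> A" "{g. f g \<noteq> 0} \<subseteq> A" "{g. h g \<noteq> 0} \<subseteq> A"
    by (auto simp: A_def)
  then show ?thesis
    by (simp add: extend distrib_left mult.left_commute sum.distrib sum_distrib_left)
qed

lemma mr_extend_sum:
  assumes "\<And>i. i \<in> I \<Longrightarrow> mr_elem M (f i)"
  shows "mr_extend \<phi> (\<lambda>g. \<Sum>i\<in>I. f i g) = (\<Sum>i\<in>I. mr_extend \<phi> (f i))"
  using assms
proof (induction I rule: infinite_finite_induct)
  case (insert i I)
  have "mr_extend \<phi> (\<lambda>g. f i g + 1 * (\<Sum>i\<in>I. f i g))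
      = mr_extend \<phi> (f i) + 1 * mr_extend \<phi> (\<lambda>g. \<Sum>i\<in>I. f i g)"
    using insert.prems by (intro mr_extend_add_scale mr_elem_sum) auto
  with insert show ?case by simp
qed (simp_all add: mr_extend_def)

lemma mr_mult_eq_extend:
  assumes f: "mr_elem M f" and h: "mr_elem M' h"
  shows "mr_mult G f h g = mr_extend (\<lambda>a. mr_extend (\<lambda>b. of_bool (a \<otimes>\<^bsub>G\<^esub> b = g)) h) f"
proof -
  have "mr_mult G f h g = (\<Sum>x\<in>{a. f a \<noteq> 0} \<times> {b. h b \<noteq> 0}.
      of_bool (fst x \<otimes>\<^bsub>G\<^esub> snd x = g) * (f (fst x) * h (snd x)))"
    unfolding mr_mult_def
    by (rule sum.mono_neutral_cong_left) (use f h in \<open>auto simp: mr_elem_def\<close>)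
  then show ?thesis
    by (simp add: mr_extend_def sum.cartesian_product case_prod_unfold sum_distrib_left mult_ac)
qed

lemma mr_extend_mult:
  assumes f: "mr_elem M f" and h: "mr_elem M' h"
  shows "mr_extend \<phi> (mr_mult G f h) = mr_extend (\<lambda>a. mr_extend (\<lambda>b. \<phi> (a \<otimes>\<^bsub>G\<^esub> b)) h) f"
proof -
  define A where "A = {a. f a \<noteq> 0}"
  define B where "B = {b. h b \<noteq> 0}"
  define S where "S = (\<lambda>(a, b). a \<otimes>\<^bsub>G\<^esub> b) ` (A \<times> B)"
  have fin: "finite A" "finite B" "finite S"
    using f h by (auto simp: A_def B_def S_def mr_elem_def)
  have mult: "mr_mult G f h g = (\<Sum>a\<in>A. \<Sum>b\<in>B. of_bool (a \<otimes>\<^bsub>G\<^esub> b = g) * (f a * h b))" for g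
    unfolding mr_mult_eq_extend[OF f h]
    by (simp add: mr_extend_def A_def B_def sum_distrib_left mult_ac)
  have "{g. mr_mult G f h g \<noteq> 0} \<subseteq> S"
    unfolding mult S_def by (auto elim!: sum.not_neutral_contains_not_neutral)
  then have "mr_extend \<phi> (mr_mult G f h)
      = (\<Sum>g\<in>S. \<Sum>a\<in>A. \<Sum>b\<in>B. if a \<otimes>\<^bsub>G\<^esub> b = g then \<phi> g * (f a * h b) else 0)"
    using fin by (simp add: mr_extend_eq_sum[of S] mult sum_distrib_left of_bool_def if_distrib
        if_distribR cong: if_cong)
  also have "\<dots> = (\<Sum>a\<in>A. \<Sum>b\<in>B. \<Sum>g\<in>S. if a \<otimes>\<^bsub>G\<^esub> b = g then \<phi> g * (f a * h b) else 0)"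
    by (subst sum.swap, rule sum.cong[OF refl], rule sum.swap)
  also have "\<dots> = (\<Sum>a\<in>A. \<Sum>b\<in>B. \<phi> (a \<otimes>\<^bsub>G\<^esub> b) * (f a * h b))"
    using fin(3) by (intro sum.cong refl) (auto simp: S_def)
  finally show ?thesis
    by (simp add: mr_extend_def A_def B_def sum_distrib_left mult_ac)
qed

definition mr_lincomb ::
  "('g, 'b) monoid_scheme \<Rightarrow> 'i set \<Rightarrow> ('i \<Rightarrow> 'g \<Rightarrow> int) \<Rightarrow> ('i \<Rightarrow> 'g \<Rightarrow> int) \<Rightarrow> 'g \<Rightarrow> int" where
  "mr_lincomb G I y d = (\<lambda>g. \<Sum>i\<in>I. mr_mult G (y i) (d i) g)"

lemma mr_lincomb_single:
  assumes "finite I" "i \<in> I"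
  shows "mr_lincomb G I (\<lambda>k. if k = i then f else (\<lambda>_. 0)) d = mr_mult G f (d i)"
proof
  fix g
  have "mr_lincomb G I (\<lambda>k. if k = i then f else (\<lambda>_. 0)) d g
      = (\<Sum>k\<in>I. if k = i then mr_mult G f (d k) g else 0)"
    unfolding mr_lincomb_def by (rule sum.cong) (auto simp: mr_mult_def)
  then show "mr_lincomb G I (\<lambda>k. if k = i then f else (\<lambda>_. 0)) d g = mr_mult G f (d i) g"
    using assms by simp
qed

definition mr_left_ideal ::
  "('g, 'b) monoid_scheme \<Rightarrow> 'g set \<Rightarrow> 'i set \<Rightarrow> ('i \<Rightarrow> 'g \<Rightarrow> int) \<Rightarrow> ('g \<Rightarrow> int) set" where
  "mr_left_ideal G M I d = {mr_lincomb G I y d |y. \<forall>i\<in>I. mr_elem M (y i)}"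

lemma mr_left_idealI: "(\<And>i. i \<in> I \<Longrightarrow> mr_elem M (y i)) \<Longrightarrow> mr_lincomb G I y d \<in> mr_left_ideal G M I d"
  by (auto simp: mr_left_ideal_def)

lemma mr_left_ideal_reindex:
  assumes e: "bij_betw e J I"
  shows "mr_left_ideal G M J (\<lambda>j. d (e j)) = mr_left_ideal G M I d"
proof
  show "mr_left_ideal G M J (\<lambda>j. d (e j)) \<subseteq> mr_left_ideal G M I d"
  proof
    fix x assume "x \<in> mr_left_ideal G M J (\<lambda>j. d (e j))"
    then obtain y where y: "\<And>j. j \<in> J \<Longrightarrow> mr_elem M (y j)" "x = mr_lincomb G J y (\<lambda>j. d (e j))"
      unfolding mr_left_ideal_def by blast
    define e' where "e' = inv_into J e"
    have e': "bij_betw e' I J" "\<And>i. i \<in> I \<Longrightarrow> e (e' i) = i"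
      using bij_betw_inv_into[OF e] bij_betw_inv_into_right[OF e] by (auto simp: e'_def)
    have "x = mr_lincomb G I (\<lambda>i. y (e' i)) d"
      using e'(2) by (simp add: y(2) mr_lincomb_def sum.reindex_bij_betw[OF e'(1), symmetric])
    then show "x \<in> mr_left_ideal G M I d"
      using y(1) bij_betwE[OF e'(1)] by (auto intro!: mr_left_idealI)
  qed
  show "mr_left_ideal G M I d \<subseteq> mr_left_ideal G M J (\<lambda>j. d (e j))"
  proof
    fix x assume "x \<in> mr_left_ideal G M I d"
    then obtain y where y: "\<And>i. i \<in> I \<Longrightarrow> mr_elem M (y i)" "x = mr_lincomb G I y d"
      unfolding mr_left_ideal_def by blast
    have "x = mr_lincomb G J (\<lambda>j. y (e j)) (\<lambda>j. d (e j))"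
      by (simp add: y(2) mr_lincomb_def sum.reindex_bij_betw[OF e, symmetric])
    then show "x \<in> mr_left_ideal G M J (\<lambda>j. d (e j))"
      using y(1) bij_betwE[OF e] by (auto intro!: mr_left_idealI)
  qed
qed

locale monoid_submonoid = monoid G + submonoid M G for G (structure) and M
begin

lemma mr_elem_mult:
  assumes f: "mr_elem M f" and h: "mr_elem M h"
  shows "mr_elem M (mr_mult G f h)"
proof (rule mr_elemI)
  show "{g. mr_mult G f h g \<noteq> 0} \<subseteq> (\<lambda>(a, b). a \<otimes> b) ` ({a. f a \<noteq> 0} \<times> {b. h b \<noteq> 0})"
    unfolding mr_mult_def by (auto elim!: sum.not_neutral_contains_not_neutral)
qed (use assms in \<open>auto simp: mr_elem_def\<close>)

lemma mr_extend_lincomb: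
  assumes "\<And>i. i \<in> I \<Longrightarrow> mr_elem M (y i)" "\<And>i. i \<in> I \<Longrightarrow> mr_elem M (d i)"
  shows "mr_extend \<phi> (mr_lincomb G I y d)
    = (\<Sum>i\<in>I. mr_extend (\<lambda>a. mr_extend (\<lambda>b. \<phi> (a \<otimes> b)) (d i)) (y i))"
proof -
  have "mr_extend \<phi> (mr_lincomb G I y d) = (\<Sum>i\<in>I. mr_extend \<phi> (mr_mult G (y i) (d i)))"
    unfolding mr_lincomb_def using assms by (intro mr_extend_sum[of _ M] mr_elem_mult)
  also have "\<dots> = (\<Sum>i\<in>I. mr_extend (\<lambda>a. mr_extend (\<lambda>b. \<phi> (a \<otimes> b)) (d i)) (y i))"
    using assms by (intro sum.cong refl mr_extend_mult)
  finally show ?thesis .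
qed

lemma mr_mult_single_one:
  assumes "mr_elem M h"
  shows "mr_mult G (mr_single \<one>) h = h"
proof
  fix g
  have "mr_mult G (mr_single \<one>) h g = mr_extend (\<lambda>b. of_bool (\<one> \<otimes> b = g)) h"
    using mr_mult_eq_extend[OF mr_elem_single[OF one_closed] assms] by simp
  also have "\<dots> = mr_extend (mr_single g) h"
    using subset by (intro mr_extend_cong[OF assms]) (auto simp: mr_single_def)
  finally show "mr_mult G (mr_single \<one>) h g = h g"
    by (simp add: mr_extend_by_single[OF assms])
qed

lemma zero_in_mr_left_ideal: "(\<lambda>g. 0) \<in> mr_left_ideal G M I d"
proof -
  have "mr_lincomb G I (\<lambda>i g. 0) d = (\<lambda>g. 0)"
    by (auto simp: mr_lincomb_def mr_mult_def)
  then show ?thesis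
    using mr_left_idealI[of I M "\<lambda>i g. 0" G d] by (simp add: mr_elem_zero)
qed

lemma mr_left_ideal_add_scale:
  assumes d: "\<And>i. i \<in> I \<Longrightarrow> mr_elem M (d i)"
    and x: "x \<in> mr_left_ideal G M I d" and x': "x' \<in> mr_left_ideal G M I d"
  shows "(\<lambda>g. x g + k * x' g) \<in> mr_left_ideal G M I d"
proof -
  obtain y y' where y: "\<And>i. i \<in> I \<Longrightarrow> mr_elem M (y i)" "x = mr_lincomb G I y d"
    and y': "\<And>i. i \<in> I \<Longrightarrow> mr_elem M (y' i)" "x' = mr_lincomb G I y' d"
    using x x' unfolding mr_left_ideal_def by blast
  define w where "w = (\<lambda>i g. y i g + k * y' i g)"
  have w: "mr_elem M (w i)" if "i \<in> I" for i
    using that y y' by (simp add: w_def mr_elem_add_scale)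
  have "mr_mult G (w i) (d i) g = mr_mult G (y i) (d i) g + k * mr_mult G (y' i) (d i) g"
    if "i \<in> I" for i g
    unfolding mr_mult_eq_extend[OF w[OF that] d[OF that]]
      mr_mult_eq_extend[OF y(1)[OF that] d[OF that]] mr_mult_eq_extend[OF y'(1)[OF that] d[OF that]]
    unfolding w_def by (rule mr_extend_add_scale[OF y(1)[OF that] y'(1)[OF that]])
  then have "(\<lambda>g. x g + k * x' g) = mr_lincomb G I w d"
    by (simp add: y(2) y'(2) mr_lincomb_def sum.distrib sum_distrib_left)
  then show ?thesis
    using mr_left_idealI[OF w] by simp
qed

lemma mr_left_ideal_sum:
  assumes d: "\<And>i. i \<in> I \<Longrightarrow> mr_elem M (d i)"
    and x: "\<And>m. m \<in> A \<Longrightarrow> x m \<in> mr_left_ideal G M I d"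
  shows "(\<lambda>g. \<Sum>m\<in>A. k m * x m g) \<in> mr_left_ideal G M I d"
  using x
proof (induction A rule: infinite_finite_induct)
  case (insert m A)
  then show ?case
    using mr_left_ideal_add_scale[OF d insert.IH, of "x m" "k m"] by (simp add: add.commute)
qed (simp_all add: zero_in_mr_left_ideal)

end

section \<open>The FP_1 condition and Cayley graphs\<close>

definition cayley_step :: "('g, 'b) monoid_scheme \<Rightarrow> 'g set \<Rightarrow> 'g set \<Rightarrow> 'g \<Rightarrow> 'g \<Rightarrow> bool" where
  "cayley_step G A F g h \<longleftrightarrow> g \<in> A \<and> h \<in> A \<and> (\<exists>f\<in>F. h = g \<otimes>\<^bsub>G\<^esub> f)"

abbreviation cayley_linked :: "('g, 'b) monoid_scheme \<Rightarrow> 'g set \<Rightarrow> 'g set \<Rightarrow> 'g \<Rightarrow> 'g \<Rightarrow> bool" where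
  "cayley_linked G A F \<equiv> equivclp (cayley_step G A F)"

definition cayley_connected :: "('g, 'b) monoid_scheme \<Rightarrow> 'g set \<Rightarrow> 'g set \<Rightarrow> bool" where
  "cayley_connected G M F \<longleftrightarrow> (\<forall>m\<in>M. cayley_linked G M F \<one>\<^bsub>G\<^esub> m)"

context monoid_submonoid
begin

lemma invariant_extend_lincomb_eq_0:
  assumes D: "\<And>i j. i < n1 \<Longrightarrow> j < n0 \<Longrightarrow> mr_elem M (D i j)"
    and rows: "\<And>i. i < n1 \<Longrightarrow> (\<Sum>j<n0. mr_aug (D i j) * c j) = 0"
    and y: "\<And>i. i < n1 \<Longrightarrow> mr_elem M (y i)"
    and invariant: "\<And>a b i j. a \<in> M \<Longrightarrow> i < n1 \<Longrightarrow> j < n0 \<Longrightarrow> D i j b \<noteq> 0 \<Longrightarrow> \<phi> (a \<otimes> b) = \<phi> a"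
  shows "(\<Sum>j<n0. mr_extend \<phi> (mr_lincomb G {..<n1} y (\<lambda>i. D i j)) * c j) = 0"
proof -
  have "mr_extend (\<lambda>a. mr_extend (\<lambda>b. \<phi> (a \<otimes> b)) (D i j)) (y i)
      = mr_extend \<phi> (y i) * mr_aug (D i j)" if ij: "i < n1" "j < n0" for i j
  proof -
    have "mr_extend (\<lambda>b. \<phi> (a \<otimes> b)) (D i j) = \<phi> a * mr_aug (D i j)" if "a \<in> M" for a
      unfolding mr_extend_def mr_aug_def sum_distrib_left
      by (rule sum.cong) (use invariant[OF that ij] in auto)
    then show ?thesis
      unfolding mr_extend_mult_const[symmetric] by (rule mr_extend_cong[OF y[OF ij(1)]])
  qed
  then have "mr_extend \<phi> (mr_lincomb G {..<n1} y (\<lambda>i. D i j))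
      = (\<Sum>i<n1. mr_extend \<phi> (y i) * mr_aug (D i j))" if "j < n0" for j
    using that D y by (subst mr_extend_lincomb) auto
  then have "(\<Sum>j<n0. mr_extend \<phi> (mr_lincomb G {..<n1} y (\<lambda>i. D i j)) * c j)
      = (\<Sum>j<n0. \<Sum>i<n1. mr_extend \<phi> (y i) * (mr_aug (D i j) * c j))"
    by (simp add: sum_distrib_right mult.assoc)
  also have "\<dots> = (\<Sum>i<n1. mr_extend \<phi> (y i) * (\<Sum>j<n0. mr_aug (D i j) * c j))"
    by (subst sum.swap) (simp add: sum_distrib_left)
  also have "\<dots> = 0"
    by (simp add: rows)
  finally show ?thesis .
qed

definition minus_one :: "'a \<Rightarrow> 'a \<Rightarrow> int" where
  "minus_one m = (\<lambda>g. mr_single m g - mr_single \<one> g)"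

lemma mr_elem_minus_one: "m \<in> M \<Longrightarrow> mr_elem M (minus_one m)"
  using mr_elem_add_scale[OF mr_elem_single mr_elem_single[OF one_closed], where k = "- 1"]
  by (simp add: minus_one_def)

lemma mr_extend_minus_one:
  assumes "m \<in> M"
  shows "mr_extend \<phi> (minus_one m) = \<phi> m - \<phi> \<one>"
  using mr_extend_add_scale[OF mr_elem_single[OF assms] mr_elem_single[OF one_closed],
      where k = "- 1"]
  by (simp add: minus_one_def)

lemma cayley_connected_if_exact:
  assumes D: "\<And>i j. i < n1 \<Longrightarrow> j < n0 \<Longrightarrow> mr_elem M (D i j)"
    and rows: "\<And>i. i < n1 \<Longrightarrow> (\<Sum>j<n0. mr_aug (D i j) * c j) = 0"
    and exact: "\<And>x. \<forall>j<n0. mr_elem M (x j) \<Longrightarrow> (\<Sum>j<n0. mr_aug (x j) * c j) = 0 \<Longrightarrow>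
      \<exists>y. (\<forall>i<n1. mr_elem M (y i)) \<and> (\<forall>j<n0. x j = mr_lincomb G {..<n1} y (\<lambda>i. D i j))"
    and x0: "(\<Sum>j<n0. mr_aug (x0 j) * c j) = 1"
    and F: "F \<subseteq> M" "\<And>i j b. i < n1 \<Longrightarrow> j < n0 \<Longrightarrow> D i j b \<noteq> 0 \<Longrightarrow> b \<in> F"
  shows "cayley_connected G M F"
  unfolding cayley_connected_def
proof
  fix m assume m: "m \<in> M"
  define \<phi> :: "'a \<Rightarrow> int" where "\<phi> = (\<lambda>g. of_bool (cayley_linked G M F \<one> g))"
  have invariant: "\<phi> (a \<otimes> b) = \<phi> a" if "a \<in> M" "i < n1" "j < n0" "D i j b \<noteq> 0" for a b i j
  proof -
    have "b \<in> F"
      using that F(2) by blast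
    then have "cayley_step G M F a (a \<otimes> b)"
      using F(1) \<open>a \<in> M\<close> by (auto simp: cayley_step_def)
    then show ?thesis
      unfolding \<phi>_def by (auto intro: equivclp_into_equivclp)
  qed
  define x where "x = (\<lambda>j g. 0 + mr_aug (x0 j) * minus_one m g)"
  have x_elem: "mr_elem M (x j)" for j
    unfolding x_def using m by (intro mr_elem_add_scale mr_elem_zero mr_elem_minus_one)
  have extend_x: "mr_extend \<psi> (x j) = mr_aug (x0 j) * (\<psi> m - \<psi> \<one>)" for \<psi> j
    unfolding x_def mr_extend_add_scale[OF mr_elem_zero mr_elem_minus_one[OF m]]
      mr_extend_minus_one[OF m] by simp
  have "(\<Sum>j<n0. mr_aug (x j) * c j) = 0"
    by (simp add: mr_aug_eq_extend extend_x)
  then obtain y where y: "\<And>i. i < n1 \<Longrightarrow> mr_elem M (y i)"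
    and xy: "\<And>j. j < n0 \<Longrightarrow> x j = mr_lincomb G {..<n1} y (\<lambda>i. D i j)"
    using exact[of x] x_elem by auto
  have "\<phi> m - \<phi> \<one> = (\<Sum>j<n0. mr_aug (x0 j) * c j) * (\<phi> m - \<phi> \<one>)"
    by (simp add: x0)
  also have "\<dots> = (\<Sum>j<n0. mr_extend \<phi> (x j) * c j)"
    by (simp add: extend_x sum_distrib_left mult_ac)
  also have "\<dots> = (\<Sum>j<n0. mr_extend \<phi> (mr_lincomb G {..<n1} y (\<lambda>i. D i j)) * c j)"
    by (simp add: xy)
  also have "\<dots> = 0"
    by (rule invariant_extend_lincomb_eq_0[of n1 n0 D c y \<phi>, OF D rows y invariant])
  finally show "cayley_linked G M F \<one> m"
    by (simp add: \<phi>_def split: if_splits)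
qed

lemma FP1_over_imp_cayley_connected:
  assumes "FP1_over G M"
  shows "\<exists>F. finite F \<and> F \<subseteq> M \<and> cayley_connected G M F"
proof -
  obtain n0 n1 :: nat and D :: "nat \<Rightarrow> nat \<Rightarrow> 'a \<Rightarrow> int" and c :: "nat \<Rightarrow> int"
    where "\<forall>i<n1. \<forall>j<n0. mr_elem M (D i j)"
      "\<forall>z. \<exists>x. (\<forall>j<n0. mr_elem M (x j)) \<and> (\<Sum>j<n0. mr_aug (x j) * c j) = z"
      "\<forall>x. (\<forall>j<n0. mr_elem M (x j)) \<longrightarrow> ((\<Sum>j<n0. mr_aug (x j) * c j) = 0 \<longleftrightarrow>
        (\<exists>y. (\<forall>i<n1. mr_elem M (y i)) \<and> (\<forall>j<n0. x j = mr_lincomb G {..<n1} y (\<lambda>i. D i j))))"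
    using assms unfolding FP1_over_def mr_lincomb_def[symmetric] by (elim exE conjE) (rule that)
  note D = this(1)[rule_format] and surj = this(2)[rule_format] and exact = this(3)[rule_format]
  define F where "F = (\<Union>i<n1. \<Union>j<n0. {x. D i j x \<noteq> 0})"
  have F: "finite F" "F \<subseteq> M" "\<And>i j b. i < n1 \<Longrightarrow> j < n0 \<Longrightarrow> D i j b \<noteq> 0 \<Longrightarrow> b \<in> F"
    using D by (auto simp: F_def mr_elem_def)
  have rows: "(\<Sum>j<n0. mr_aug (D i j) * c j) = 0" if i: "i < n1" for i
  proof (rule exact[THEN iffD2])
    let ?y = "\<lambda>k. if k = i then mr_single \<one> else (\<lambda>_. 0)"
    show "\<exists>y. (\<forall>k<n1. mr_elem M (y k)) \<and> (\<forall>j<n0. D i j = mr_lincomb G {..<n1} y (\<lambda>i. D i j))"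
      using i D by (intro exI[of _ ?y])
        (simp add: mr_lincomb_single mr_mult_single_one mr_elem_single mr_elem_zero)
  qed (use D i in auto)
  obtain x0 :: "nat \<Rightarrow> 'a \<Rightarrow> int" where x0: "(\<Sum>j<n0. mr_aug (x0 j) * c j) = 1"
    using surj[of 1] by blast
  have "cayley_connected G M F"
    by (rule cayley_connected_if_exact[OF D rows exact[THEN iffD1] x0 F(2,3)]) simp_all
  with F show ?thesis
    by blast
qed

lemma single_diff_in_mr_left_ideal:
  assumes F: "finite F" "F \<subseteq> M" and a: "a \<in> M" and f: "f \<in> F"
  shows "(\<lambda>g. mr_single (a \<otimes> f) g - mr_single a g) \<in> mr_left_ideal G M F minus_one"
proof -
  have aG: "a \<in> carrier G" and fM: "f \<in> M"
    using a f F subset by auto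
  have "mr_mult G (mr_single a) (minus_one f) g = mr_single (a \<otimes> f) g - mr_single a g" for g
    unfolding mr_mult_eq_extend[OF mr_elem_single[OF a] mr_elem_minus_one[OF fM]]
      mr_extend_single mr_extend_minus_one[OF fM]
    using aG by (auto simp: mr_single_def)
  then have "(\<lambda>g. mr_single (a \<otimes> f) g - mr_single a g) = mr_mult G (mr_single a) (minus_one f)"
    by auto
  also have "\<dots> = mr_lincomb G F (\<lambda>k. if k = f then mr_single a else (\<lambda>_. 0)) minus_one"
    by (rule mr_lincomb_single[OF F(1) f, symmetric])
  also have "\<dots> \<in> mr_left_ideal G M F minus_one"
    using a by (intro mr_left_idealI) (simp add: mr_elem_single mr_elem_zero)
  finally show ?thesis .
qed

lemma minus_one_in_mr_left_ideal:
  assumes F: "finite F" "F \<subseteq> M" and conn: "cayley_connected G M F" and m: "m \<in> M"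
  shows "minus_one m \<in> mr_left_ideal G M F minus_one" (is "_ \<in> ?J")
proof -
  have F_elem: "mr_elem M (minus_one f)" if "f \<in> F" for f
    using that F by (intro mr_elem_minus_one) auto
  have step_iff: "minus_one (a \<otimes> f) \<in> ?J \<longleftrightarrow> minus_one a \<in> ?J" if "a \<in> M" "f \<in> F" for a f
  proof
    assume "minus_one a \<in> ?J"
    from mr_left_ideal_add_scale[of F minus_one, OF F_elem this
        single_diff_in_mr_left_ideal[OF F that], of 1]
    show "minus_one (a \<otimes> f) \<in> ?J"
      by (simp add: minus_one_def[of a] minus_one_def[of "a \<otimes> f"])
  next
    assume "minus_one (a \<otimes> f) \<in> ?J"
    from mr_left_ideal_add_scale[of F minus_one, OF F_elem this
        single_diff_in_mr_left_ideal[OF F that], of "- 1"]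
    show "minus_one a \<in> ?J"
      by (simp add: minus_one_def[of a] minus_one_def[of "a \<otimes> f"])
  qed
  have "cayley_linked G M F \<one> m"
    using conn m by (simp add: cayley_connected_def)
  then show ?thesis
  proof (induction rule: equivclp_induct)
    case base
    show ?case
      using zero_in_mr_left_ideal by (simp add: minus_one_def[of \<one>])
  next
    case (step a b)
    then show ?case
      using step_iff by (auto simp: cayley_step_def)
  qed
qed

lemma mr_aug_eq_0_iff_in_left_ideal:
  assumes F: "finite F" "F \<subseteq> M" and conn: "cayley_connected G M F" and x: "mr_elem M x"
  shows "mr_aug x = 0 \<longleftrightarrow> x \<in> mr_left_ideal G M F minus_one"
proof
  have F_elem: "mr_elem M (minus_one f)" if "f \<in> F" for f
    using that F by (intro mr_elem_minus_one) auto
  assume aug: "mr_aug x = 0"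
  define A where "A = {g. x g \<noteq> 0}"
  have A: "finite A" "A \<subseteq> M"
    using x by (auto simp: A_def mr_elem_def)
  have "(\<Sum>m\<in>A. x m * minus_one m g) = x g" for g
  proof -
    have "(\<Sum>m\<in>A. x m * minus_one m g) = (\<Sum>m\<in>A. x m * mr_single m g) - mr_aug x * mr_single \<one> g"
      by (simp add: minus_one_def mr_aug_def A_def right_diff_distrib sum_subtractf
          sum_distrib_right)
    also have "(\<Sum>m\<in>A. x m * mr_single m g) = x g"
      using A(1) by (simp add: mr_single_def of_bool_def if_distrib A_def cong: if_cong)
    finally show ?thesis
      by (simp add: aug)
  qed
  then show "x \<in> mr_left_ideal G M F minus_one"
    using mr_left_ideal_sum[where I = F and d = minus_one and A = A and x = minus_one and k = x]
      F_elem minus_one_in_mr_left_ideal[OF F conn] A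
    by auto
next
  assume "x \<in> mr_left_ideal G M F minus_one"
  then obtain y where y: "\<And>f. f \<in> F \<Longrightarrow> mr_elem M (y f)" "x = mr_lincomb G F y minus_one"
    unfolding mr_left_ideal_def by blast
  have "mr_extend (\<lambda>b. 1) (minus_one f) = 0" if "f \<in> F" for f
    using that F by (subst mr_extend_minus_one) auto
  moreover have "mr_aug x = (\<Sum>f\<in>F. mr_extend (\<lambda>a. mr_extend (\<lambda>b. 1) (minus_one f)) (y f))"
    unfolding mr_aug_eq_extend y(2) using F y(1) by (intro mr_extend_lincomb mr_elem_minus_one) auto
  ultimately show "mr_aug x = 0"
    by simp
qed

lemma cayley_connected_imp_FP1_over:
  assumes F: "finite F" "F \<subseteq> M" and conn: "cayley_connected G M F"
  shows "FP1_over G M"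
proof -
  obtain n and e :: "nat \<Rightarrow> 'a" where e: "bij_betw e {..<n} F"
    using ex_bij_betw_nat_finite[OF F(1)] by (auto simp: atLeast0LessThan)
  define D where "D = (\<lambda>i (j::nat). minus_one (e i))"
  have D_elem: "mr_elem M (D i j)" if "i < n" for i j
    unfolding D_def using that F(2) bij_betwE[OF e] by (intro mr_elem_minus_one) auto
  have surj: "\<exists>x. (\<forall>j<1. mr_elem M (x j)) \<and> (\<Sum>j<1::nat. mr_aug (x j) * 1) = k" for k :: int
  proof (rule exI, rule conjI)
    let ?x = "\<lambda>(j::nat) g. 0 + k * mr_single \<one> g"
    show "\<forall>j<1. mr_elem M (?x j)"
      by (intro allI impI mr_elem_add_scale mr_elem_zero mr_elem_single one_closed)
    show "(\<Sum>j<1::nat. mr_aug (?x j) * 1) = k"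
      using mr_extend_add_scale[OF mr_elem_zero mr_elem_single[OF one_closed], where k = k]
      by (simp add: mr_aug_eq_extend)
  qed
  have ideal_eq: "mr_left_ideal G M {..<n} (\<lambda>i. D i 0) = mr_left_ideal G M F minus_one"
    unfolding D_def by (rule mr_left_ideal_reindex[OF e])
  have exact: "mr_aug x = 0 \<longleftrightarrow>
      (\<exists>y. (\<forall>i<n. mr_elem M (y i)) \<and> x = mr_lincomb G {..<n} y (\<lambda>i. D i 0))"
    if "mr_elem M x" for x
    unfolding mr_aug_eq_0_iff_in_left_ideal[OF F conn that] ideal_eq[symmetric]
    by (auto simp: mr_left_ideal_def)
  show ?thesis
    unfolding FP1_over_def mr_lincomb_def[symmetric]
  proof (rule exI[of _ 1], rule exI[of _ n], rule exI[of _ D], rule exI[of _ "\<lambda>_. 1"],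
      intro conjI allI impI)
    show "mr_elem M (D i j)" if "i < n" "j < 1" for i j
      using that(1) by (rule D_elem)
    show "\<exists>x. (\<forall>j<1. mr_elem M (x j)) \<and> (\<Sum>j<1::nat. mr_aug (x j) * 1) = k" for k
      by (rule surj)
    show "(\<Sum>j<1::nat. mr_aug (x j) * 1) = 0 \<longleftrightarrow>
        (\<exists>y. (\<forall>i<n. mr_elem M (y i)) \<and> (\<forall>j<1. x j = mr_lincomb G {..<n} y (\<lambda>i. D i j)))"
      if "\<forall>j<1. mr_elem M (x j)" for x
      using that exact[of "x 0"] by simp
  qed
qed

lemma FP1_over_iff_cayley_connected:
  "FP1_over G M \<longleftrightarrow> (\<exists>F. finite F \<and> F \<subseteq> M \<and> cayley_connected G M F)"
  using FP1_over_imp_cayley_connected cayley_connected_imp_FP1_over by blast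

end

section \<open>Characters and half-spaces\<close>

locale group_character = group G for G (structure) +
  fixes \<chi> :: "'a \<Rightarrow> real"
  assumes character: "character G \<chi>"
begin

lemma char_mult: "x \<in> carrier G \<Longrightarrow> y \<in> carrier G \<Longrightarrow> \<chi> (x \<otimes> y) = \<chi> x + \<chi> y"
  using character by (simp add: character_def)

lemma char_one: "\<chi> \<one> = 0"
  using char_mult[of \<one> \<one>] by simp

lemma char_inv: "x \<in> carrier G \<Longrightarrow> \<chi> (inv x) = - \<chi> x"
  using char_mult[of "inv x" x] char_one by simp

lemma char_pow: "x \<in> carrier G \<Longrightarrow> \<chi> (x [^] (n::nat)) = real n * \<chi> x"
  by (induction n) (simp_all add: char_one char_mult distrib_right)

lemma char_eq_0_if_generators:
  assumes S: "S \<subseteq> carrier G" "carrier G \<subseteq> generate G S"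
    and zero: "\<And>s. s \<in> S \<Longrightarrow> \<chi> s = 0" and g: "g \<in> carrier G"
  shows "\<chi> g = 0"
proof -
  have "subgroup {g \<in> carrier G. \<chi> g = 0} G"
    by (rule subgroupI) (auto simp: char_one char_mult char_inv)
  then have "generate G S \<subseteq> {g \<in> carrier G. \<chi> g = 0}"
    using S(1) zero by (intro generate_subgroup_incl) auto
  then show ?thesis
    using S(2) g by blast
qed

definition half_space :: "real \<Rightarrow> 'a set" where
  "half_space r = {g \<in> carrier G. r \<le> \<chi> g}"

lemma in_Sigma1_iff_cayley_connected:
  "in_Sigma1 G \<chi> \<longleftrightarrow>
    (\<exists>F. finite F \<and> F \<subseteq> half_space 0 \<and> cayley_connected G (half_space 0) F)"
proof -
  interpret monoid_submonoid G "half_space 0"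
    by unfold_locales (auto simp: half_space_def char_one char_mult)
  show ?thesis
    unfolding in_Sigma1_def half_space_def[of 0, symmetric] by (rule FP1_over_iff_cayley_connected)
qed

abbreviation linked :: "'a set \<Rightarrow> real \<Rightarrow> 'a \<Rightarrow> 'a \<Rightarrow> bool" where
  "linked F r \<equiv> cayley_linked G (half_space r) F"

lemma linked_mono:
  assumes "linked F r g h" "r' \<le> r"
  shows "linked F r' g h"
  using assms(1)
proof (induction rule: equivclp_induct)
  case base
  show ?case by simp
next
  case (step y z)
  then have "cayley_step G (half_space r') F y z \<or> cayley_step G (half_space r') F z y"
    using assms(2) by (auto simp: cayley_step_def half_space_def)
  with step.IH show ?case
    by (rule equivclp_into_equivclp)
qed

lemma linked_translate:
  assumes F: "F \<subseteq> carrier G" and k: "k \<in> carrier G" and "linked F r g h"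
  shows "linked F (r + \<chi> k) (k \<otimes> g) (k \<otimes> h)"
  using assms(3)
proof (induction rule: equivclp_induct)
  case base
  show ?case by simp
next
  case (step y z)
  have translate: "cayley_step G (half_space (r + \<chi> k)) F (k \<otimes> y) (k \<otimes> z)"
    if yz: "cayley_step G (half_space r) F y z" for y z
  proof -
    obtain f where f: "f \<in> F" "z = y \<otimes> f"
      using yz by (auto simp: cayley_step_def)
    have "y \<in> half_space r" "z \<in> half_space r"
      using yz by (simp_all add: cayley_step_def)
    with f F k show ?thesis
      by (auto simp: cayley_step_def half_space_def char_mult subset_iff m_assoc
          intro!: bexI[of _ f])
  qed
  from step show ?case
    using translate by (blast intro: equivclp_into_equivclp)
qed

lemma linked_mult:
  assumes "F \<subseteq> carrier G" "f \<in> F" "g \<in> carrier G" "r \<le> \<chi> g" "r \<le> \<chi> g + \<chi> f"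
  shows "linked F r g (g \<otimes> f)"
  using assms by (intro r_into_equivclp) (auto simp: cayley_step_def half_space_def char_mult)

lemma linked_pow:
  assumes F: "F \<subseteq> carrier G" "f \<in> F" and f: "0 \<le> \<chi> f" and g: "g \<in> carrier G" "r \<le> \<chi> g"
  shows "linked F r g (g \<otimes> f [^] (n::nat))"
proof (induction n)
  case 0
  show ?case
    using g by simp
next
  case (Suc n)
  have fG: "f \<in> carrier G"
    using F by blast
  have "linked F r (g \<otimes> f [^] n) (g \<otimes> f [^] n \<otimes> f)"
    using F f g fG by (intro linked_mult) (simp_all add: char_mult char_pow add_increasing2)
  with Suc have "linked F r g (g \<otimes> f [^] n \<otimes> f)"
    by (rule equivclp_trans)
  then show ?case
    using g fG by (simp add: m_assoc)
qed

text \<open>Far out, the rays of two commuting elements are joined by the commutation square.\<close>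
lemma linked_commuting_rays:
  assumes F: "F \<subseteq> carrier G" "t \<in> F" "t' \<in> F" and pos: "0 \<le> \<chi> t" "0 \<le> \<chi> t'"
    and comm: "t \<otimes> t' = t' \<otimes> t" and r: "r \<le> real n * \<chi> t" "r \<le> real n' * \<chi> t'"
  shows "linked F r (t [^] (n::nat)) (t' [^] (n'::nat))"
proof -
  have t: "t \<in> carrier G" "t' \<in> carrier G"
    using F by auto
  have "linked F r (t [^] n) (t [^] n \<otimes> t' [^] n')"
    using F pos r t by (intro linked_pow) (auto simp: char_pow)
  also have "t [^] n \<otimes> t' [^] n' = t' [^] n' \<otimes> t [^] n"
    using t comm by (metis group_commutes_pow nat_pow_closed)
  also have "linked F r (t' [^] n' \<otimes> t [^] n) (t' [^] n')"
    using F pos r t by (intro equivclp_sym[OF linked_pow]) (auto simp: char_pow)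
  finally show ?thesis .
qed

end

lemma ex_nat_mult_ge:
  fixes c r :: real
  assumes "0 < c"
  obtains n :: nat where "r \<le> real n * c"
proof -
  obtain n :: nat where "r / c \<le> real n"
    using real_arch_simple by blast
  with assms show ?thesis
    by (intro that[of n]) (simp add: field_simps)
qed

section \<open>Commuting graphs\<close>

definition commuting_edge :: "('g, 'b) monoid_scheme \<Rightarrow> 'g set \<Rightarrow> 'g \<Rightarrow> 'g \<Rightarrow> bool" where
  "commuting_edge G T x y \<longleftrightarrow> x \<in> T \<and> y \<in> T \<and> x \<otimes>\<^bsub>G\<^esub> y = y \<otimes>\<^bsub>G\<^esub> x"

lemma (in group) commutes_inv:
  assumes "x \<otimes> y = y \<otimes> x" "x \<in> carrier G" "y \<in> carrier G"
  shows "x \<otimes> inv y = inv y \<otimes> x"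
  using assms by (metis inv_closed inv_solve_left inv_solve_right m_assoc m_closed)

locale dominating_commuting_graph = group_character G \<chi> for G (structure) and \<chi> +
  fixes S T :: "'a set" and t0 :: 'a
  assumes finite_S: "finite S" and S_carrier: "S \<subseteq> carrier G"
    and S_generates: "carrier G \<subseteq> generate G S"
    and finite_T: "finite T" and T_subset: "T \<subseteq> carrier G"
    and T_pos: "\<And>t. t \<in> T \<Longrightarrow> 0 < \<chi> t" and t0_in_T: "t0 \<in> T"
    and connected: "\<And>t. t \<in> T \<Longrightarrow> (commuting_edge G T)\<^sup>*\<^sup>* t0 t"
    and dominating: "\<And>s. s \<in> S \<Longrightarrow> \<exists>t\<in>T. s \<otimes> t = t \<otimes> s"
begin

definition letters :: "'a set" where
  "letters = T \<union> {s \<in> S \<union> m_inv G ` S. 0 \<le> \<chi> s}"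

lemma finite_letters: "finite letters"
  using finite_S finite_T by (simp add: letters_def)

lemma letters_subset: "letters \<subseteq> half_space 0"
  using S_carrier T_subset T_pos by (auto simp: letters_def half_space_def subset_iff less_imp_le)

lemma letters_carrier: "letters \<subseteq> carrier G"
  using letters_subset by (auto simp: half_space_def)

lemma T_letters: "t \<in> T \<Longrightarrow> t \<in> letters"
  by (simp add: letters_def)

lemma T_carrier: "t \<in> T \<Longrightarrow> t \<in> carrier G"
  using T_subset by auto

lemma linked_rays:
  assumes t: "t \<in> T" and r: "r \<le> real n * \<chi> t0" "r \<le> real n' * \<chi> t"
  shows "linked letters r (t0 [^] (n::nat)) (t [^] (n'::nat))"
  using connected[OF t] r(2)
proof (induction arbitrary: n' rule: rtranclp_induct)
  case base
  then show ?case
    using T_pos t0_in_T r(1)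
    by (intro linked_commuting_rays letters_carrier T_letters) (auto simp: less_imp_le)
next
  case (step y z)
  then have yz: "y \<in> T" "z \<in> T" "y \<otimes> z = z \<otimes> y"
    by (auto simp: commuting_edge_def)
  obtain k :: nat where k: "r \<le> real k * \<chi> y"
    using ex_nat_mult_ge T_pos[OF yz(1)] by blast
  have "linked letters r (y [^] k) (z [^] n')"
    using yz T_pos k step.prems
    by (intro linked_commuting_rays letters_carrier T_letters) (auto simp: less_imp_le)
  with step.IH[OF k] show ?case
    by (rule equivclp_trans)
qed

lemma linked_generator:
  assumes s: "s \<in> S \<union> m_inv G ` S" and g: "g \<in> carrier G" "r \<le> \<chi> g" "r \<le> \<chi> g + \<chi> s"
  shows "linked letters r g (g \<otimes> s)"
proof (cases "0 \<le> \<chi> s")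
  case True
  then have "s \<in> letters"
    using s by (auto simp: letters_def)
  then show ?thesis
    using g by (intro linked_mult letters_carrier)
next
  case False
  have sG: "s \<in> carrier G"
    using s S_carrier by auto
  have "inv s \<in> S \<union> m_inv G ` S"
    using s S_carrier by (auto simp: subset_iff)
  then have "inv s \<in> letters"
    using False by (auto simp: letters_def char_inv[OF sG])
  then have "linked letters r (g \<otimes> s) (g \<otimes> s \<otimes> inv s)"
    using g sG by (intro linked_mult letters_carrier) (auto simp: char_mult char_inv)
  then show ?thesis
    using g sG by (simp add: m_assoc equivclp_sym)
qed

lemma ex_commuting_T:
  assumes "s \<in> S \<union> m_inv G ` S"
  obtains t where "t \<in> T" "t \<otimes> s = s \<otimes> t"
proof -
  obtain s' t where s': "s' \<in> S" "s = s' \<or> s = inv s'" and t: "t \<in> T" "s' \<otimes> t = t \<otimes> s'"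
    using assms dominating by blast
  then have "t \<otimes> inv s' = inv s' \<otimes> t"
    using S_carrier T_carrier by (intro commutes_inv) auto
  with s' t show ?thesis
    by (intro that[of t]) auto
qed

definition asymptotic :: "'a \<Rightarrow> bool" where
  "asymptotic g \<longleftrightarrow>
    (\<exists>K. \<forall>n::nat. linked letters (real n * \<chi> t0 - K) (t0 [^] n) (g \<otimes> t0 [^] n))"

lemma asymptotic_generator:
  assumes s: "s \<in> S \<union> m_inv G ` S"
  shows "asymptotic s"
  unfolding asymptotic_def
proof (intro exI allI)
  fix n :: nat
  let ?r = "real n * \<chi> t0 - \<bar>\<chi> s\<bar>"
  have sG: "s \<in> carrier G"
    using s S_carrier by auto
  obtain t where t: "t \<in> T" "t \<otimes> s = s \<otimes> t"
    using ex_commuting_T[OF s] .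
  note tG = T_carrier[OF t(1)]
  obtain k :: nat where k: "real n * \<chi> t0 \<le> real k * \<chi> t"
    using ex_nat_mult_ge T_pos[OF t(1)] by blast
  have ray: "linked letters (real n * \<chi> t0) (t0 [^] n) (t [^] k)"
    using k by (intro linked_rays t) auto
  then have "linked letters ?r (t0 [^] n) (t [^] k)"
    by (rule linked_mono) simp
  also have "linked letters ?r (t [^] k) (t [^] k \<otimes> s)"
    using k tG by (intro linked_generator s) (auto simp: char_pow)
  also have "t [^] k \<otimes> s = s \<otimes> t [^] k"
    using group_commutes_pow[OF t(2) tG sG] .
  also have "linked letters ?r (s \<otimes> t [^] k) (s \<otimes> t0 [^] n)"
    by (rule linked_mono[OF equivclp_sym[OF linked_translate[OF letters_carrier sG ray]]]) simp
  finally show "linked letters ?r (t0 [^] n) (s \<otimes> t0 [^] n)" .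
qed

lemma asymptotic_mult:
  assumes g: "g \<in> carrier G" "asymptotic g" and h: "h \<in> carrier G" "asymptotic h"
  shows "asymptotic (g \<otimes> h)"
proof -
  obtain K K' where K: "\<And>n::nat. linked letters (real n * \<chi> t0 - K) (t0 [^] n) (g \<otimes> t0 [^] n)"
    and K': "\<And>n::nat. linked letters (real n * \<chi> t0 - K') (t0 [^] n) (h \<otimes> t0 [^] n)"
    using g h unfolding asymptotic_def by blast
  define L where "L = max K (K' - \<chi> g)"
  have "linked letters (real n * \<chi> t0 - L) (t0 [^] n) (g \<otimes> h \<otimes> t0 [^] n)" for n :: nat
  proof -
    have "linked letters (real n * \<chi> t0 - L) (t0 [^] n) (g \<otimes> t0 [^] n)"
      by (rule linked_mono[OF K]) (simp add: L_def)
    also have "linked letters (real n * \<chi> t0 - L) (g \<otimes> t0 [^] n) (g \<otimes> (h \<otimes> t0 [^] n))"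
      by (rule linked_mono[OF linked_translate[OF letters_carrier g(1) K']]) (simp add: L_def)
    finally show ?thesis
      using g h T_carrier[OF t0_in_T] by (simp add: m_assoc)
  qed
  then show ?thesis
    unfolding asymptotic_def by blast
qed

lemma asymptotic_all:
  assumes "g \<in> carrier G"
  shows "asymptotic g"
proof -
  have "g \<in> generate G S"
    using assms S_generates by auto
  then show ?thesis
  proof (induction rule: generate.induct)
    case one
    have "linked letters (real n * \<chi> t0 - 0) (t0 [^] n) (\<one> \<otimes> t0 [^] n)" for n :: nat
      using T_carrier[OF t0_in_T] by simp
    then show ?case
      unfolding asymptotic_def by blast
  next
    case (eng h1 h2)
    then show ?case
      using asymptotic_mult generate_in_carrier[OF S_carrier] by blast
  qed (use asymptotic_generator in auto)
qed

lemma in_Sigma1: "in_Sigma1 G \<chi>"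
proof -
  have "linked letters 0 \<one> m" if m: "m \<in> half_space 0" for m
  proof -
    have mG: "m \<in> carrier G" "0 \<le> \<chi> m"
      using m by (auto simp: half_space_def)
    obtain K where K: "\<And>n::nat. linked letters (real n * \<chi> t0 - K) (t0 [^] n) (m \<otimes> t0 [^] n)"
      using asymptotic_all[OF mG(1)] unfolding asymptotic_def by blast
    obtain n :: nat where n: "K \<le> real n * \<chi> t0"
      using ex_nat_mult_ge T_pos[OF t0_in_T] by blast
    have up: "linked letters 0 g (g \<otimes> t0 [^] n)" if "g \<in> carrier G" "0 \<le> \<chi> g" for g
      using that T_pos t0_in_T
      by (intro linked_pow letters_carrier T_letters) (auto simp: less_imp_le)
    have "linked letters 0 \<one> (t0 [^] n)"
      using up[of \<one>] T_carrier[OF t0_in_T] by (simp add: char_one)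
    also have "linked letters 0 (t0 [^] n) (m \<otimes> t0 [^] n)"
      by (rule linked_mono[OF K]) (use n in simp)
    also have "linked letters 0 (m \<otimes> t0 [^] n) m"
      using up[OF mG] by (rule equivclp_sym)
    finally show ?thesis .
  qed
  then show ?thesis
    unfolding in_Sigma1_iff_cayley_connected cayley_connected_def
    using finite_letters letters_subset by blast
qed

end

lemma (in group_character) in_Sigma1_if_dominating_commuting_graph:
  assumes S: "finite S" "S \<subseteq> carrier G" "carrier G \<subseteq> generate G S"
    and T: "finite T" "T \<subseteq> carrier G" "\<And>t. t \<in> T \<Longrightarrow> \<chi> t \<noteq> 0" "t0 \<in> T"
    and connected: "\<And>t. t \<in> T \<Longrightarrow> (commuting_edge G T)\<^sup>*\<^sup>* t0 t"
    and dominating: "\<And>s. s \<in> S \<Longrightarrow> \<exists>t\<in>T. s \<otimes> t = t \<otimes> s"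
  shows "in_Sigma1 G \<chi>"
proof -
  define pos where "pos = (\<lambda>t. if 0 < \<chi> t then t else inv t)"
  have TG: "t \<in> carrier G" if "t \<in> T" for t
    using T(2) that by auto
  have posG: "pos t \<in> carrier G" if "t \<in> carrier G" for t
    using that by (simp add: pos_def)
  have pos_comm: "x \<otimes> pos y = pos y \<otimes> x"
    if "x \<otimes> y = y \<otimes> x" "x \<in> carrier G" "y \<in> carrier G" for x y
    using that commutes_inv by (simp add: pos_def)
  have pos_edge: "commuting_edge G (pos ` T) (pos y) (pos z)" if "commuting_edge G T y z" for y z
    using that pos_comm[of y z] pos_comm[of "pos z" y] posG TG by (simp add: commuting_edge_def)
  interpret dominating_commuting_graph G \<chi> S "pos ` T" "pos t0"
  proof
    show "finite S" "S \<subseteq> carrier G" "carrier G \<subseteq> generate G S"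
      by (fact S)+
    show "finite (pos ` T)" "pos ` T \<subseteq> carrier G" "pos t0 \<in> pos ` T"
      using T posG by auto
    show "0 < \<chi> t" if "t \<in> pos ` T" for t
      using that T(3) TG by (force simp: pos_def char_inv)
    show "\<exists>t\<in>pos ` T. s \<otimes> t = t \<otimes> s" if "s \<in> S" for s
      using dominating[OF that] pos_comm S(2) TG that by blast
    show "(commuting_edge G (pos ` T))\<^sup>*\<^sup>* (pos t0) t" if t: "t \<in> pos ` T" for t
    proof -
      obtain u where u: "u \<in> T" "t = pos u"
        using t by blast
      from connected[OF u(1)] show ?thesis
        unfolding u(2)
        by (induction rule: rtranclp_induct) (auto intro: rtranclp.rtrancl_into_rtrancl pos_edge)
    qed
  qed
  show ?thesis
    by (rule in_Sigma1)
qed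

section \<open>Braid relations\<close>

fun alt_prod :: "('g, 'b) monoid_scheme \<Rightarrow> 'g \<Rightarrow> 'g \<Rightarrow> nat \<Rightarrow> 'g" where
  "alt_prod G x y 0 = \<one>\<^bsub>G\<^esub>"
| "alt_prod G x y (Suc n) = x \<otimes>\<^bsub>G\<^esub> alt_prod G y x n"

abbreviation conj_by :: "('g, 'b) monoid_scheme \<Rightarrow> 'g \<Rightarrow> 'g \<Rightarrow> 'g" where
  "conj_by G s x \<equiv> s \<otimes>\<^bsub>G\<^esub> x \<otimes>\<^bsub>G\<^esub> inv\<^bsub>G\<^esub> s"

definition braid_rel :: "('g, 'b) monoid_scheme \<Rightarrow> nat \<Rightarrow> 'g \<Rightarrow> 'g \<Rightarrow> bool" where
  "braid_rel G m x y \<longleftrightarrow> alt_prod G x y m = alt_prod G y x m"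

lemma braid_rel_sym: "braid_rel G m x y \<longleftrightarrow> braid_rel G m y x"
  by (auto simp: braid_rel_def)

context monoid
begin

lemma alt_prod_closed [simp]: "x \<in> carrier G \<Longrightarrow> y \<in> carrier G \<Longrightarrow> alt_prod G x y n \<in> carrier G"
  by (induction n arbitrary: x y) simp_all

lemma alt_prod_Suc_right:
  assumes "x \<in> carrier G" "y \<in> carrier G"
  shows "alt_prod G x y (Suc n) = alt_prod G x y n \<otimes> (if even n then x else y)"
  using assms
proof (induction n arbitrary: x y)
  case (Suc n)
  have "alt_prod G x y (Suc (Suc n)) = x \<otimes> (alt_prod G y x n \<otimes> (if even n then y else x))"
    using Suc.IH[OF Suc.prems(2,1)] by simp
  with Suc.prems show ?case
    by (simp add: m_assoc)
qed simp

lemma alt_prod_even: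
  assumes "x \<in> carrier G" "y \<in> carrier G"
  shows "alt_prod G x y (2 * k) = (x \<otimes> y) [^] k"
proof (induction k)
  case (Suc k)
  have "alt_prod G x y (2 * Suc k) = (x \<otimes> y) \<otimes> alt_prod G x y (2 * k)"
    using assms by (simp add: m_assoc)
  with Suc assms show ?case
    using nat_pow_Suc2[of "x \<otimes> y" k] by simp
qed simp

lemma braid_rel_one_even: "x \<in> carrier G \<Longrightarrow> braid_rel G (2 * k) x \<one>"
  by (simp add: braid_rel_def alt_prod_even)

end

context group
begin

lemma conj_by_mult:
  assumes "s \<in> carrier G" "x \<in> carrier G" "y \<in> carrier G"
  shows "conj_by G s x \<otimes> conj_by G s y = conj_by G s (x \<otimes> y)"
proof -
  have "inv s \<otimes> (s \<otimes> (y \<otimes> inv s)) = y \<otimes> inv s"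
    using assms by (simp flip: m_assoc)
  with assms show ?thesis
    by (simp add: m_assoc)
qed

lemma alt_prod_conj:
  assumes "s \<in> carrier G" "x \<in> carrier G" "y \<in> carrier G"
  shows "alt_prod G (conj_by G s x) (conj_by G s y) n = conj_by G s (alt_prod G x y n)"
  using assms by (induction n arbitrary: x y) (simp_all add: conj_by_mult)

lemma braid_rel_conj:
  assumes "s \<in> carrier G" "x \<in> carrier G" "y \<in> carrier G" "braid_rel G m x y"
  shows "braid_rel G m (conj_by G s x) (conj_by G s y)"
  using assms by (simp add: braid_rel_def alt_prod_conj)

lemma pow_mult_eq_one_commute:
  assumes x: "x \<in> carrier G" and y: "y \<in> carrier G" and one: "(x \<otimes> y) [^] (k::nat) = \<one>"
  shows "(y \<otimes> x) [^] k = \<one>"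
proof -
  have "x \<otimes> (y \<otimes> x) [^] k = alt_prod G x y (Suc (2 * k))"
    using x y by (simp add: alt_prod_even)
  also have "\<dots> = x"
    using alt_prod_Suc_right[OF x y, of "2 * k"] x y one by (simp add: alt_prod_even)
  finally show ?thesis
    using x y by simp
qed

lemma braid_rel_if_pow_eq_one:
  assumes "x \<in> carrier G" "y \<in> carrier G" "(x \<otimes> y) [^] (k::nat) = \<one>"
  shows "braid_rel G (2 * k) x y"
  using assms pow_mult_eq_one_commute[OF assms] by (simp add: braid_rel_def alt_prod_even)

lemma braid_rel_conj_alt_prod:
  assumes "x \<in> carrier G" "y \<in> carrier G" "braid_rel G m x y"
  shows "x \<otimes> alt_prod G x y m = alt_prod G x y m \<otimes> (if even m then x else y)"
proof -
  have "x \<otimes> alt_prod G x y m = alt_prod G x y (Suc m)"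
    using assms(3) by (simp add: braid_rel_def)
  then show ?thesis
    using assms by (simp only: alt_prod_Suc_right)
qed

lemma braid_rel_square_commutes:
  assumes xy: "x \<in> carrier G" "y \<in> carrier G" and braid: "braid_rel G m x y"
  shows "x \<otimes> (alt_prod G x y m \<otimes> alt_prod G x y m) = alt_prod G x y m \<otimes> alt_prod G x y m \<otimes> x"
proof -
  define d where "d = alt_prod G x y m"
  define z where "z = (if even m then x else y)"
  have G: "d \<in> carrier G" "z \<in> carrier G"
    using xy by (simp_all add: d_def z_def)
  have xd: "x \<otimes> d = d \<otimes> z"
    unfolding d_def z_def by (rule braid_rel_conj_alt_prod) fact+
  have "alt_prod G y x m = d"
    using braid by (simp add: d_def braid_rel_def)
  then have "y \<otimes> d = d \<otimes> (if even m then y else x)"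
    using braid_rel_conj_alt_prod[OF xy(2,1), of m] braid by (simp add: braid_rel_sym)
  with xd have zd: "z \<otimes> d = d \<otimes> x"
    by (auto simp: z_def)
  have "x \<otimes> (d \<otimes> d) = d \<otimes> (z \<otimes> d)"
    using xd G xy by (metis m_assoc)
  also have "\<dots> = d \<otimes> d \<otimes> x"
    using zd G xy by (simp add: m_assoc)
  finally show ?thesis
    by (simp add: d_def)
qed

end

lemma (in group_character) char_alt_prod_add_swap:
  assumes "x \<in> carrier G" "y \<in> carrier G"
  shows "\<chi> (alt_prod G x y n) + \<chi> (alt_prod G y x n) = real n * (\<chi> x + \<chi> y)"
  using assms by (induction n arbitrary: x y) (simp_all add: char_one char_mult algebra_simps)

section \<open>Artin groups\<close>

lemma artin_class_eq_iff:
  "artin_class E lab w = artin_class E lab w' \<longleftrightarrow> artin_rel E lab w w'"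
  unfolding artin_class_def
  by (auto intro: ar_refl ar_sym ar_trans)

lemma artin_rel_append:
  assumes "artin_rel E lab x x'" "artin_rel E lab y y'"
  shows "artin_rel E lab (x @ y) (x' @ y')"
  using ar_cong[OF assms(1), of "[]" y] ar_cong[OF assms(2), of x' "[]"]
  by (auto intro: ar_trans)

lemma artin_rel_cancel_word:
  "artin_rel E lab (rev (map (\<lambda>(v, b). (v, \<not> b)) w) @ w) []"
proof (induction w)
  case Nil
  show ?case by (simp add: ar_refl)
next
  case (Cons l w)
  obtain v b where l: "l = (v, b)" by (cases l)
  let ?i = "rev (map (\<lambda>(v, b). (v, \<not> b)) w)"
  have "artin_rel E lab (?i @ [(v, \<not> b), (v, \<not> \<not> b)] @ w) (?i @ [] @ w)"
    by (intro ar_cong ar_cancel)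
  with Cons show ?case
    by (auto simp: l intro: ar_trans)
qed

lemma artin_mult:
  "artin_class E lab x \<otimes>\<^bsub>artin_group V E lab\<^esub> artin_class E lab y = artin_class E lab (x @ y)"
  by (auto simp: artin_group_def artin_class_def intro: ar_refl ar_trans ar_sym artin_rel_append)

lemma artin_one: "\<one>\<^bsub>artin_group V E lab\<^esub> = artin_class E lab []"
  by (simp add: artin_group_def)

lemma artin_carrier: "carrier (artin_group V E lab) = artin_class E lab ` lists (V \<times> UNIV)"
  by (simp add: artin_group_def)

lemma artin_class_in_carrier:
  "w \<in> lists (V \<times> UNIV) \<Longrightarrow> artin_class E lab w \<in> carrier (artin_group V E lab)"
  by (simp add: artin_carrier)

lemma artin_gen_in_carrier: "v \<in> V \<Longrightarrow> artin_gen E lab v \<in> carrier (artin_group V E lab)"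
  unfolding artin_gen_def by (rule artin_class_in_carrier) simp

lemma group_artin_group: "group (artin_group V E lab)"
proof (rule groupI)
  fix x assume "x \<in> carrier (artin_group V E lab)"
  then obtain w where w: "w \<in> lists (V \<times> UNIV)" "x = artin_class E lab w"
    by (auto simp: artin_carrier)
  then have "rev (map (\<lambda>(v, b). (v, \<not> b)) w) \<in> lists (V \<times> UNIV)"
    by (auto simp: in_lists_conv_set)
  then show "\<exists>y\<in>carrier (artin_group V E lab). y \<otimes>\<^bsub>artin_group V E lab\<^esub> x = \<one>\<^bsub>artin_group V E lab\<^esub>"
    unfolding w(2) using artin_rel_cancel_word[of E lab w]
    by (intro bexI[OF _ artin_class_in_carrier])
      (auto simp: artin_mult artin_one artin_class_eq_iff)
next
  fix x y assume "x \<in> carrier (artin_group V E lab)" "y \<in> carrier (artin_group V E lab)"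
  then obtain w w' where "w \<in> lists (V \<times> UNIV)" "x = artin_class E lab w"
    "w' \<in> lists (V \<times> UNIV)" "y = artin_class E lab w'"
    by (auto simp: artin_carrier)
  then show "x \<otimes>\<^bsub>artin_group V E lab\<^esub> y \<in> carrier (artin_group V E lab)"
    by (simp only: artin_mult, intro artin_class_in_carrier) simp
qed (auto simp: artin_carrier artin_mult artin_one)

lemma inv_artin_gen:
  assumes "v \<in> V"
  shows "inv\<^bsub>artin_group V E lab\<^esub> (artin_gen E lab v) = artin_class E lab [(v, True)]"
proof (rule group.inv_equality[OF group_artin_group])
  show "artin_class E lab [(v, True)] \<otimes>\<^bsub>artin_group V E lab\<^esub> artin_gen E lab v
      = \<one>\<^bsub>artin_group V E lab\<^esub>"
    using ar_cancel[of E lab v True]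
    by (simp add: artin_gen_def artin_mult artin_one artin_class_eq_iff)
qed (use assms in \<open>auto simp: artin_gen_in_carrier artin_class_in_carrier\<close>)

lemma artin_group_generated:
  "carrier (artin_group V E lab) \<subseteq> generate (artin_group V E lab) (artin_gen E lab ` V)"
  (is "_ \<subseteq> ?H")
proof
  fix x assume "x \<in> carrier (artin_group V E lab)"
  then obtain w where w: "w \<in> lists (V \<times> UNIV)" "x = artin_class E lab w"
    by (auto simp: artin_carrier)
  show "x \<in> ?H"
    unfolding w(2) using w(1)
  proof (induction w)
    case Nil
    show ?case by (metis generate.one artin_one)
  next
    case (Cons l w)
    obtain v b where l: "l = (v, b)" by (cases l)
    have "artin_gen E lab v \<in> artin_gen E lab ` V" and v: "v \<in> V"
      using Cons.hyps by (simp_all add: l)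
    then have "artin_class E lab [l] \<in> ?H"
      using generate.inv[of "artin_gen E lab v" _ "artin_group V E lab"]
      by (cases b) (simp_all add: l inv_artin_gen generate.incl flip: artin_gen_def)
    then have "artin_class E lab [l] \<otimes>\<^bsub>artin_group V E lab\<^esub> artin_class E lab w \<in> ?H"
      using Cons.IH by (rule generate.eng)
    then show ?case
      by (simp add: artin_mult)
  qed
qed

lemma alt_word_0: "alt_word u v 0 = []"
  by (simp add: alt_word_def)

lemma alt_word_Suc: "alt_word u v (Suc n) = (u, False) # alt_word v u n"
proof -
  have "[0..<Suc n] = 0 # map Suc [0..<n]"
    by (simp add: upt_conv_Cons map_Suc_upt del: upt_Suc)
  then show ?thesis
    unfolding alt_word_def by (simp del: upt_Suc)
qed

lemma artin_class_alt_word: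
  "artin_class E lab (alt_word u v n)
    = alt_prod (artin_group V E lab) (artin_gen E lab u) (artin_gen E lab v) n"
proof (induction n arbitrary: u v)
  case (Suc n)
  show ?case
    by (simp add: alt_word_Suc flip: Suc) (simp add: artin_gen_def artin_mult)
qed (simp add: alt_word_0 artin_one)

lemma braid_rel_artin_gen:
  "E u v \<Longrightarrow> braid_rel (artin_group V E lab) (lab u v) (artin_gen E lab u) (artin_gen E lab v)"
  unfolding braid_rel_def artin_class_alt_word[symmetric] artin_class_eq_iff by (rule ar_braid)

definition braid_family ::
  "('g, 'b) monoid_scheme \<Rightarrow> ('v \<Rightarrow> 'v \<Rightarrow> bool) \<Rightarrow> ('v \<Rightarrow> 'v \<Rightarrow> nat) \<Rightarrow> ('v \<Rightarrow> 'g) \<Rightarrow> bool" where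
  "braid_family H E lab f \<longleftrightarrow>
    (\<forall>v. f v \<in> carrier H) \<and> (\<forall>u v. E u v \<longrightarrow> braid_rel H (lab u v) (f u) (f v))"

lemma braid_familyD:
  assumes "braid_family H E lab f"
  shows "f v \<in> carrier H" "E u v \<Longrightarrow> braid_rel H (lab u v) (f u) (f v)"
  using assms by (auto simp: braid_family_def)

fun word_val :: "('g, 'b) monoid_scheme \<Rightarrow> ('v \<Rightarrow> 'g) \<Rightarrow> ('v \<times> bool) list \<Rightarrow> 'g" where
  "word_val H f [] = \<one>\<^bsub>H\<^esub>"
| "word_val H f ((v, b) # w) = (if b then inv\<^bsub>H\<^esub> f v else f v) \<otimes>\<^bsub>H\<^esub> word_val H f w"

lemma word_val_alt_word: "word_val H f (alt_word u v n) = alt_prod H (f u) (f v) n"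
  by (induction n arbitrary: u v) (simp_all add: alt_word_0 alt_word_Suc)

context group
begin

lemma word_val_closed [simp]: "(\<And>v. f v \<in> carrier G) \<Longrightarrow> word_val G f w \<in> carrier G"
  by (induction w) auto

lemma word_val_append:
  "(\<And>v. f v \<in> carrier G) \<Longrightarrow> word_val G f (w @ w') = word_val G f w \<otimes> word_val G f w'"
  by (induction w) (auto simp: m_assoc)

lemma word_val_artin_rel:
  assumes f: "braid_family G E lab f" and "artin_rel E lab w w'"
  shows "word_val G f w = word_val G f w'"
  using assms(2)
proof (induction rule: artin_rel.induct)
  case (ar_cong w w' a b)
  then show ?case
    using braid_familyD(1)[OF f] by (simp add: word_val_append)
next
  case (ar_cancel v b)
  show ?case
    using braid_familyD(1)[OF f, of v] by simp
next
  case (ar_braid u v)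
  then show ?case
    using braid_familyD(2)[OF f] by (simp add: word_val_alt_word braid_rel_def)
qed simp_all

lemma artin_group_universal:
  assumes f: "braid_family G E lab f"
  obtains \<phi> where "\<phi> \<in> hom (artin_group V E lab) G" "\<And>v. \<phi> (artin_gen E lab v) = f v"
proof
  define \<phi> where "\<phi> = (\<lambda>g. word_val G f (SOME w. artin_class E lab w = g))"
  have \<phi>_class: "\<phi> (artin_class E lab w) = word_val G f w" for w
  proof -
    have "artin_class E lab (SOME w'. artin_class E lab w' = artin_class E lab w)
        = artin_class E lab w"
      by (rule someI) simp
    then show ?thesis
      unfolding \<phi>_def by (intro word_val_artin_rel[OF f]) (simp add: artin_class_eq_iff)
  qed
  note fG = braid_familyD(1)[OF f]
  show "\<phi> \<in> hom (artin_group V E lab) G"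
    by (rule homI) (auto simp: artin_carrier artin_mult \<phi>_class word_val_append fG)
  show "\<phi> (artin_gen E lab v) = f v" for v
    using fG[of v] by (simp add: artin_gen_def \<phi>_class)
qed

end

section \<open>Sufficiency\<close>

locale artin_character =
  fixes V :: "'v set" and E :: "'v \<Rightarrow> 'v \<Rightarrow> bool" and lab :: "'v \<Rightarrow> 'v \<Rightarrow> nat"
    and \<chi> :: "('v \<times> bool) list set \<Rightarrow> real"
  assumes graph: "labelled_graph V E lab"
    and artin_character: "character (artin_group V E lab) \<chi>"
begin

abbreviation "G \<equiv> artin_group V E lab"
abbreviation "gen \<equiv> artin_gen E lab"
abbreviation "ht \<equiv> \<lambda>v. \<chi> (artin_gen E lab v)"
abbreviation "live \<equiv> live_vertex V E lab \<chi>"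

sublocale group_character G \<chi>
  by (intro group_character.intro group_character_axioms.intro group_artin_group artin_character)

lemma finite_V: "finite V"
  using graph by (simp add: labelled_graph_def)

lemma edgeD:
  assumes "E u v"
  shows "u \<in> V" "v \<in> V" "u \<noteq> v" "E v u" "lab v u = lab u v" "2 \<le> lab u v"
  using graph assms by (auto simp: labelled_graph_def)

lemma liveD:
  assumes "live v"
  shows "v \<in> V" "ht v \<noteq> 0"
  using assms by (auto simp: live_vertex_def)

lemma gen_carrier [simp]: "v \<in> V \<Longrightarrow> gen v \<in> carrier G"
  by (rule artin_gen_in_carrier)

lemma gen_edge_carrier:
  assumes "E u v"
  shows "gen u \<in> carrier G" "gen v \<in> carrier G"
  using edgeD[OF assms] by simp_all

lemma braid_rel_gen: "E u v \<Longrightarrow> braid_rel G (lab u v) (gen u) (gen v)"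
  by (rule braid_rel_artin_gen)

lemma odd_edge_ht:
  assumes e: "E u v" and "odd (lab u v)"
  shows "ht u = ht v"
proof -
  let ?d = "alt_prod G (gen u) (gen v) (lab u v)"
  have "gen u \<otimes>\<^bsub>G\<^esub> ?d = ?d \<otimes>\<^bsub>G\<^esub> gen v"
    using braid_rel_conj_alt_prod[OF gen_edge_carrier[OF e] braid_rel_gen] e assms(2) by simp
  then have "\<chi> (gen u \<otimes>\<^bsub>G\<^esub> ?d) = \<chi> (?d \<otimes>\<^bsub>G\<^esub> gen v)"
    by simp
  then show ?thesis
    using gen_edge_carrier[OF e] by (simp add: char_mult)
qed

lemma live_edge_ht_sum:
  assumes "live_edge V E lab \<chi> u v" "lab u v \<noteq> 2"
  shows "ht u + ht v \<noteq> 0"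
proof (cases "even (lab u v)")
  case True
  then show ?thesis
    using assms edgeD(6)[of u v] by (auto simp: live_edge_def dead_edge_def)
next
  case False
  have "E u v" "live u"
    using assms(1) by (auto simp: live_edge_def)
  then show ?thesis
    using odd_edge_ht False liveD(2)[of u] by simp
qed

definition garside_sq :: "'v \<Rightarrow> 'v \<Rightarrow> ('v \<times> bool) list set" where
  "garside_sq u v = alt_prod G (gen u) (gen v) (lab u v) \<otimes>\<^bsub>G\<^esub> alt_prod G (gen u) (gen v) (lab u v)"

lemma garside_sq_carrier: "E u v \<Longrightarrow> garside_sq u v \<in> carrier G"
  unfolding garside_sq_def using gen_edge_carrier by simp

lemma garside_sq_sym: "E u v \<Longrightarrow> garside_sq v u = garside_sq u v"
  using braid_rel_gen[of u v] edgeD(5) by (simp add: garside_sq_def braid_rel_def)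

lemma garside_sq_commutes:
  assumes e: "E u v" and w: "w = u \<or> w = v"
  shows "gen w \<otimes>\<^bsub>G\<^esub> garside_sq u v = garside_sq u v \<otimes>\<^bsub>G\<^esub> gen w"
proof -
  have "gen u \<otimes>\<^bsub>G\<^esub> garside_sq u v = garside_sq u v \<otimes>\<^bsub>G\<^esub> gen u" if "E u v" for u v
    unfolding garside_sq_def
    using that by (intro braid_rel_square_commutes gen_edge_carrier braid_rel_gen)
  from this[OF e] this[OF edgeD(4)[OF e]] show ?thesis
    using w garside_sq_sym[OF e] by auto
qed

lemma char_garside_sq:
  assumes e: "E u v"
  shows "\<chi> (garside_sq u v) = real (lab u v) * (ht u + ht v)"
proof -
  have "\<chi> (garside_sq u v)
      = \<chi> (alt_prod G (gen u) (gen v) (lab u v)) + \<chi> (alt_prod G (gen v) (gen u) (lab u v))"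
    using braid_rel_gen[OF e] gen_edge_carrier[OF e]
    by (simp add: garside_sq_def char_mult braid_rel_def)
  then show ?thesis
    using gen_edge_carrier[OF e] by (simp add: char_alt_prod_add_swap)
qed

definition living_elements :: "('v \<times> bool) list set set" where
  "living_elements =
    gen ` {v. live v} \<union> {garside_sq u v |u v. E u v \<and> \<chi> (garside_sq u v) \<noteq> 0}"

abbreviation "commuting_living \<equiv> commuting_edge G living_elements"

lemma live_gen_in_living: "live v \<Longrightarrow> gen v \<in> living_elements"
  by (simp add: living_elements_def)

lemma garside_sq_in_living:
  assumes "E u v" "ht u + ht v \<noteq> 0"
  shows "garside_sq u v \<in> living_elements"
proof -
  have "\<chi> (garside_sq u v) \<noteq> 0"
    using assms edgeD(6)[of u v] by (simp add: char_garside_sq)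
  with assms show ?thesis
    unfolding living_elements_def by blast
qed

lemma living_elements_cases:
  assumes "t \<in> living_elements"
  obtains (generator) v where "live v" "t = gen v"
  | (garside) u v where "E u v" "t = garside_sq u v" "\<chi> t \<noteq> 0"
  using assms by (auto simp: living_elements_def)

lemma finite_living_elements: "finite living_elements"
proof (rule finite_subset)
  show "living_elements \<subseteq> gen ` V \<union> case_prod garside_sq ` (V \<times> V)"
    using liveD(1) edgeD(1,2) by (fastforce elim!: living_elements_cases)
qed (simp add: finite_V)

lemma living_elements_carrier: "living_elements \<subseteq> carrier G"
  using liveD(1) garside_sq_carrier by (auto elim!: living_elements_cases)

lemma char_living_element: "t \<in> living_elements \<Longrightarrow> \<chi> t \<noteq> 0"
  using liveD(2) by (auto elim!: living_elements_cases)

lemma commuting_gen_garside_sq: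
  assumes "E u v" "w = u \<or> w = v" "live w" "garside_sq u v \<in> living_elements"
  shows "commuting_living (gen w) (garside_sq u v)" "commuting_living (garside_sq u v) (gen w)"
  using assms garside_sq_commutes[OF assms(1,2)] live_gen_in_living
  by (auto simp: commuting_edge_def)

lemma live_edge_connects:
  assumes edge: "live_edge V E lab \<chi> u v"
  shows "commuting_living\<^sup>*\<^sup>* (gen u) (gen v)"
proof (cases "lab u v = 2")
  case True
  have e: "E u v" "live u" "live v"
    using edge by (auto simp: live_edge_def)
  have "gen u \<otimes>\<^bsub>G\<^esub> gen v = gen v \<otimes>\<^bsub>G\<^esub> gen u"
    using braid_rel_gen[OF e(1)] gen_edge_carrier[OF e(1)] True
    by (simp add: braid_rel_def numeral_2_eq_2)
  then have "commuting_living (gen u) (gen v)"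
    using e live_gen_in_living by (simp add: commuting_edge_def)
  then show ?thesis ..
next
  case False
  have e: "E u v" "live u" "live v"
    using edge by (auto simp: live_edge_def)
  have "garside_sq u v \<in> living_elements"
    using live_edge_ht_sum[OF edge False] by (rule garside_sq_in_living[OF e(1)])
  then have "commuting_living (gen u) (garside_sq u v)" "commuting_living (garside_sq u v) (gen v)"
    using e by (auto intro: commuting_gen_garside_sq)
  then show ?thesis
    by (rule converse_rtranclp_into_rtranclp[OF _ r_into_rtranclp])
qed

lemma living_elements_connected:
  assumes conn: "liv_connected V E lab \<chi>" and a: "live a" and t: "t \<in> living_elements"
  shows "commuting_living\<^sup>*\<^sup>* (gen a) t"
proof -
  have live_chain: "commuting_living\<^sup>*\<^sup>* (gen a) (gen v)" if v: "live v" for v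
  proof -
    have "(live_edge V E lab \<chi>)\<^sup>*\<^sup>* a v"
      using conn a v by (auto simp: liv_connected_def)
    then show ?thesis
      by (induction rule: rtranclp_induct) (auto intro: rtranclp_trans live_edge_connects)
  qed
  from t show ?thesis
  proof (cases rule: living_elements_cases)
    case (generator v)
    then show ?thesis
      using live_chain by simp
  next
    case (garside u v)
    then have "ht u \<noteq> 0 \<or> ht v \<noteq> 0"
      by (auto simp: char_garside_sq)
    then obtain w where w: "live w" "w = u \<or> w = v"
      using edgeD[OF garside(1)] by (auto simp: live_vertex_def)
    then have "commuting_living (gen w) t"
      using commuting_gen_garside_sq(1)[OF garside(1)] t by (simp add: garside(2))
    with live_chain[OF w(1)] show ?thesis
      by (rule rtranclp.rtrancl_into_rtrancl)
  qed
qed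

lemma living_elements_dominating:
  assumes dom: "liv_dominant V E lab \<chi>" and v: "v \<in> V"
  shows "\<exists>t\<in>living_elements. gen v \<otimes>\<^bsub>G\<^esub> t = t \<otimes>\<^bsub>G\<^esub> gen v"
proof (cases "live v")
  case True
  then show ?thesis
    using live_gen_in_living by blast
next
  case False
  then obtain u where u: "live u" "E v u"
    using dom v by (auto simp: liv_dominant_def)
  have "ht v = 0"
    using False v by (simp add: live_vertex_def)
  then have "garside_sq v u \<in> living_elements"
    using liveD(2)[OF u(1)] by (intro garside_sq_in_living u) simp
  then show ?thesis
    using garside_sq_commutes[OF u(2)] by blast
qed

lemma in_Sigma1_if_liv_connected_dominant:
  assumes conn: "liv_connected V E lab \<chi>" and dom: "liv_dominant V E lab \<chi>"
  shows "in_Sigma1 G \<chi>"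
proof -
  obtain a where a: "live a"
    using conn by (auto simp: liv_connected_def)
  show ?thesis
  proof (rule in_Sigma1_if_dominating_commuting_graph)
    show "finite (gen ` V)" "gen ` V \<subseteq> carrier G" "carrier G \<subseteq> generate G (gen ` V)"
      using finite_V artin_group_generated by auto
    show "finite living_elements" "living_elements \<subseteq> carrier G"
      by (rule finite_living_elements living_elements_carrier)+
    show "gen a \<in> living_elements"
      using a by (rule live_gen_in_living)
  qed (use living_elements_connected[OF conn a] living_elements_dominating[OF dom]
      char_living_element in auto)
qed

end

section \<open>Actions with an invariant end of a section\<close>

text \<open>Think of \<open>'y\<close> as a bundle over the real line with section \<open>\<sigma>\<close>, on which \<open>G\<close> acts covering the
  translations by \<open>\<chi>\<close>.\<close>
locale section_action = group_character G \<chi> + group_action G "UNIV :: 'y set" \<alpha>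
  for G :: "('a, 'b) monoid_scheme" (structure) and \<chi> and \<alpha> :: "'a \<Rightarrow> 'y \<Rightarrow> 'y" +
  fixes \<sigma> :: "real \<Rightarrow> 'y"
begin

lemma act_one: "\<alpha> \<one> y = y"
  using id_eq_one by (metis UNIV_I restrict_apply)

lemma act_mult: "g \<in> carrier G \<Longrightarrow> h \<in> carrier G \<Longrightarrow> \<alpha> (g \<otimes> h) y = \<alpha> g (\<alpha> h y)"
  by (rule composition_rule) simp_all

lemma act_inv: "g \<in> carrier G \<Longrightarrow> \<alpha> g x = y \<Longrightarrow> \<alpha> (inv g) y = x"
  by (rule orbit_sym_aux) simp_all

definition preserves :: "'a \<Rightarrow> bool" where
  "preserves g \<longleftrightarrow> (\<forall>r. \<alpha> g (\<sigma> r) = \<sigma> (r + \<chi> g))"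

definition preserves_below :: "real \<Rightarrow> 'a \<Rightarrow> bool" where
  "preserves_below B g \<longleftrightarrow> (\<forall>r. r + \<chi> g < B \<longrightarrow> \<alpha> g (\<sigma> r) = \<sigma> (r + \<chi> g))"

lemma preserves_inv:
  assumes "g \<in> carrier G" "preserves g"
  shows "preserves (inv g)"
  unfolding preserves_def
proof
  fix r
  have "\<alpha> g (\<sigma> (r - \<chi> g)) = \<sigma> r"
    using assms(2) by (simp add: preserves_def)
  then show "\<alpha> (inv g) (\<sigma> r) = \<sigma> (r + \<chi> (inv g))"
    using act_inv assms(1) by (simp add: char_inv)
qed

lemma preserves_pow:
  assumes g: "g \<in> carrier G" "preserves g"
  shows "preserves (g [^] (n::nat))"
proof (induction n)
  case 0
  show ?case
    by (simp add: preserves_def act_one char_one)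
next
  case (Suc n)
  then show ?case
    using g by (simp add: preserves_def act_mult char_mult algebra_simps)
qed

lemma preserves_below_mono: "preserves_below B g \<Longrightarrow> B' \<le> B \<Longrightarrow> preserves_below B' g"
  by (auto simp: preserves_below_def)

lemma preserves_below_one: "preserves_below B \<one>"
  by (simp add: preserves_below_def act_one char_one)

lemma preserves_below_mult:
  assumes "g \<in> carrier G" "h \<in> carrier G" "preserves_below B g" "preserves_below B' h"
  shows "preserves_below (min B (B' + \<chi> g)) (g \<otimes> h)"
  unfolding preserves_below_def
proof (intro allI impI)
  fix r assume r: "r + \<chi> (g \<otimes> h) < min B (B' + \<chi> g)"
  have gh: "\<chi> (g \<otimes> h) = \<chi> g + \<chi> h"
    using assms by (simp add: char_mult)
  have "\<alpha> h (\<sigma> r) = \<sigma> (r + \<chi> h)"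
    using assms(4) r by (simp add: preserves_below_def gh)
  moreover have "\<alpha> g (\<sigma> (r + \<chi> h)) = \<sigma> (r + \<chi> h + \<chi> g)"
    using assms(3) r by (simp add: preserves_below_def gh algebra_simps)
  ultimately show "\<alpha> (g \<otimes> h) (\<sigma> r) = \<sigma> (r + \<chi> (g \<otimes> h))"
    using assms by (simp add: act_mult gh algebra_simps)
qed

lemma preserves_below_inv:
  assumes "g \<in> carrier G" "preserves_below B g"
  shows "preserves_below (B - \<chi> g) (inv g)"
  unfolding preserves_below_def
proof (intro allI impI)
  fix r assume r: "r + \<chi> (inv g) < B - \<chi> g"
  then have "\<alpha> g (\<sigma> (r - \<chi> g)) = \<sigma> r"
    using assms by (simp add: preserves_below_def char_inv)
  then show "\<alpha> (inv g) (\<sigma> r) = \<sigma> (r + \<chi> (inv g))"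
    using act_inv assms(1) by (simp add: char_inv)
qed

lemma ex_preserves_below_if_generators:
  assumes S: "S \<subseteq> carrier G" "carrier G \<subseteq> generate G S"
    and low: "\<And>s. s \<in> S \<Longrightarrow> \<exists>B. preserves_below B s" and g: "g \<in> carrier G"
  shows "\<exists>B. preserves_below B g"
proof -
  have "subgroup {g \<in> carrier G. \<exists>B. preserves_below B g} G"
    by (rule subgroupI)
      (auto intro: preserves_below_one dest: preserves_below_mult preserves_below_inv)
  then have "generate G S \<subseteq> {g \<in> carrier G. \<exists>B. preserves_below B g}"
    using S(1) low by (intro generate_subgroup_incl) auto
  then show ?thesis
    using S(2) g by blast
qed

lemma preserves_below_mult_nonneg:
  assumes "a \<in> half_space 0" "h \<in> carrier G" "preserves_below B a" "preserves_below B h"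
  shows "preserves_below B (a \<otimes> h)"
  using assms preserves_below_mult[of a h B B]
  by (auto simp: half_space_def min_def split: if_splits)

lemma preserves_below_if_linked:
  assumes F: "F \<subseteq> half_space 0" "\<And>f. f \<in> F \<Longrightarrow> preserves_below B f \<and> preserves_below B (inv f)"
    and "linked F 0 \<one> m"
  shows "preserves_below B m"
  using assms(3)
proof (induction rule: equivclp_induct)
  case base
  show ?case
    by (rule preserves_below_one)
next
  case (step y z)
  have F_carrier: "f \<in> carrier G" if "f \<in> F" for f
    using that F(1) by (auto simp: half_space_def)
  from step.hyps(2) show ?case
  proof
    assume "cayley_step G (half_space 0) F y z"
    then show ?thesis
      using preserves_below_mult_nonneg step.IH F(2) F_carrier by (auto simp: cayley_step_def)
  next
    assume "cayley_step G (half_space 0) F z y"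
    then obtain f where f: "y \<in> half_space 0" "z \<in> carrier G" "f \<in> F" "y = z \<otimes> f"
      by (auto simp: cayley_step_def half_space_def)
    have "preserves_below B (y \<otimes> inv f)"
      using preserves_below_mult_nonneg[OF f(1) _ step.IH] F(2)[OF f(3)] F_carrier[OF f(3)] by simp
    then show ?thesis
      using f F_carrier by (simp add: m_assoc)
  qed
qed

lemma Sigma1_imp_uniformly_preserves_below:
  assumes \<Sigma>: "in_Sigma1 G \<chi>"
    and low: "\<And>g. g \<in> carrier G \<Longrightarrow> \<exists>B. preserves_below B g"
  obtains B where "\<And>m. m \<in> half_space 0 \<Longrightarrow> preserves_below B m"
proof -
  obtain F where F: "finite F" "F \<subseteq> half_space 0" "cayley_connected G (half_space 0) F"
    using \<Sigma> unfolding in_Sigma1_iff_cayley_connected by blast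
  obtain \<beta> where \<beta>: "\<And>g. g \<in> carrier G \<Longrightarrow> preserves_below (\<beta> g) g"
    using low by metis
  define B where "B = Min (insert 0 (\<beta> ` (F \<union> m_inv G ` F)))"
  have letters_low: "preserves_below B f \<and> preserves_below B (inv f)" if f: "f \<in> F" for f
  proof -
    have "f \<in> carrier G"
      using f F(2) by (auto simp: half_space_def)
    then show ?thesis
      using f F(1) by (auto intro!: preserves_below_mono[OF \<beta>] simp: B_def)
  qed
  show ?thesis
  proof
    fix m assume "m \<in> half_space 0"
    then have "linked F 0 \<one> m"
      using F(3) by (simp add: cayley_connected_def)
    with F(2) letters_low show "preserves_below B m"
      by (rule preserves_below_if_linked)
  qed
qed

lemma act_section_if_conj_preserves_below:
  assumes k: "k \<in> carrier G" "preserves k" and h: "h \<in> carrier G"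
    and below: "preserves_below B (conj_by G k h)" "r + \<chi> h + \<chi> k < B"
  shows "\<alpha> h (\<sigma> r) = \<sigma> (r + \<chi> h)"
proof -
  have inv_k: "\<alpha> (inv k) (\<sigma> (s + \<chi> k)) = \<sigma> s" for s
    using k by (intro act_inv) (simp_all add: preserves_def)
  have "\<chi> (conj_by G k h) = \<chi> h"
    using h k by (simp add: char_mult char_inv)
  then have "\<alpha> (conj_by G k h) (\<sigma> (r + \<chi> k)) = \<sigma> (r + \<chi> h + \<chi> k)"
    using below by (simp add: preserves_below_def algebra_simps)
  then have "\<alpha> k (\<alpha> h (\<sigma> r)) = \<sigma> (r + \<chi> h + \<chi> k)"
    using h k inv_k by (simp add: act_mult)
  then show ?thesis
    using act_inv[OF k(1)] inv_k by metis
qed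

text \<open>Conjugation by a large power of \<open>b\<close> moves any point of the section into the invariant end.\<close>
lemma Sigma1_imp_preserves:
  assumes \<Sigma>: "in_Sigma1 G \<chi>"
    and low: "\<And>g. g \<in> carrier G \<Longrightarrow> \<exists>B. preserves_below B g"
    and b: "b \<in> carrier G" "\<chi> b \<noteq> 0" "preserves b" and g: "g \<in> carrier G"
  shows "preserves g"
proof -
  obtain B where B: "\<And>m. m \<in> half_space 0 \<Longrightarrow> preserves_below B m"
    using Sigma1_imp_uniformly_preserves_below[OF \<Sigma> low] by blast
  obtain c where c: "c \<in> carrier G" "\<chi> c < 0" "preserves c"
    using b preserves_inv[of b] char_inv[of b] by (cases "\<chi> b < 0") (auto intro: that[of "inv b"])
  have nonneg: "preserves h" if h: "h \<in> carrier G" "0 \<le> \<chi> h" for h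
    unfolding preserves_def
  proof
    fix r
    obtain n :: nat where n: "r + \<chi> h - B + 1 \<le> real n * (- \<chi> c)"
      using ex_nat_mult_ge c(2) by (metis neg_0_less_iff_less)
    have k: "c [^] n \<in> carrier G" "preserves (c [^] n)"
      using c preserves_pow by simp_all
    have "r + \<chi> h + \<chi> (c [^] n) < B"
      using c n by (simp add: char_pow)
    moreover have "conj_by G (c [^] n) h \<in> half_space 0"
      using h k by (simp add: half_space_def char_mult char_inv)
    ultimately show "\<alpha> h (\<sigma> r) = \<sigma> (r + \<chi> h)"
      using act_section_if_conj_preserves_below k h(1) B by blast
  qed
  show ?thesis
  proof (cases "0 \<le> \<chi> g")
    case True
    with g show ?thesis
      by (rule nonneg)
  next
    case False
    then have "preserves (inv g)"
      using g by (intro nonneg) (simp_all add: char_inv)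
    then show ?thesis
      using preserves_inv[of "inv g"] g by simp
  qed
qed

end

section \<open>Twisted actions of Artin groups\<close>

abbreviation bij_group :: "('a \<Rightarrow> 'a) monoid" where
  "bij_group \<equiv> BijGroup UNIV"

lemma bij_group_simps:
  "f \<in> carrier bij_group \<longleftrightarrow> bij f"
  "bij f \<Longrightarrow> bij g \<Longrightarrow> f \<otimes>\<^bsub>bij_group\<^esub> g = f \<circ> g"
  "\<one>\<^bsub>bij_group\<^esub> = id"
  by (auto simp: BijGroup_def Bij_def compose_def)

lemma conj_bij_group_apply:
  assumes "bij s" "bij f"
  shows "(conj_by bij_group s f) (s p) = s (f p)"
proof -
  interpret group "bij_group :: ('a \<Rightarrow> 'a) monoid"
    by (rule group_BijGroup)
  have sf: "s \<in> carrier bij_group" "f \<in> carrier bij_group"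
    using assms by (simp_all add: bij_group_simps)
  let ?c = "conj_by bij_group s f"
  have "?c \<otimes>\<^bsub>bij_group\<^esub> s = s \<otimes>\<^bsub>bij_group\<^esub> f"
    using sf by (simp add: m_assoc)
  moreover have "bij ?c"
    using sf by (simp flip: bij_group_simps(1))
  ultimately show ?thesis
    using assms by (simp add: bij_group_simps fun_eq_iff)
qed

lemma nat_pow_bij_group: "bij f \<Longrightarrow> f [^]\<^bsub>bij_group\<^esub> (n::nat) = f ^^ n"
  by (induction n) (simp_all add: bij_group_simps bij_fn funpow_Suc_right del: funpow.simps(2))

definition bundle_map :: "real \<Rightarrow> ('a \<Rightarrow> 'a) \<Rightarrow> real \<times> 'a \<Rightarrow> real \<times> 'a" where
  "bundle_map c \<rho> = map_prod (\<lambda>r. r + c) \<rho>"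

lemma bundle_map_apply [simp]: "bundle_map c \<rho> (r, x) = (r + c, \<rho> x)"
  by (simp add: bundle_map_def)

lemma bundle_map_comp: "bundle_map c \<rho> \<circ> bundle_map c' \<rho>' = bundle_map (c + c') (\<rho> \<circ> \<rho>')"
  by (auto simp: fun_eq_iff)

lemma bundle_map_id: "bundle_map 0 id = id"
  by (auto simp: fun_eq_iff)

lemma bij_bundle_map: "bij \<rho> \<Longrightarrow> bij (bundle_map c \<rho>)"
  unfolding bundle_map_def UNIV_Times_UNIV[symmetric]
  by (intro bij_betw_map_prod) (simp_all add: bij_plus_right)

definition gauge :: "('a \<Rightarrow> 'a) \<Rightarrow> real \<times> 'a \<Rightarrow> real \<times> 'a" where
  "gauge \<tau> = (\<lambda>(r, x). (r, if r = 0 then \<tau> x else x))"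

lemma gauge_apply [simp]: "gauge \<tau> (r, x) = (r, if r = 0 then \<tau> x else x)"
  by (simp add: gauge_def)

lemma gauge_comp: "gauge \<tau> \<circ> gauge \<tau>' = gauge (\<tau> \<circ> \<tau>')"
  by (auto simp: fun_eq_iff)

lemma gauge_id: "gauge id = id"
  by (auto simp: fun_eq_iff)

lemma gauge_funpow: "gauge \<tau> ^^ n = gauge (\<tau> ^^ n)"
  by (induction n) (auto simp: fun_eq_iff)

lemma bij_gauge:
  assumes "bij \<tau>"
  shows "bij (gauge \<tau>)"
proof (rule o_bij)
  show "gauge (inv_into UNIV \<tau>) \<circ> gauge \<tau> = id" "gauge \<tau> \<circ> gauge (inv_into UNIV \<tau>) = id"
    using assms
    by (simp_all add: gauge_comp gauge_id bij_is_inj surj_iff[THEN iffD1, OF bij_is_surj])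
qed

definition (in group) twist :: "'a \<Rightarrow> 'v set \<Rightarrow> ('v \<Rightarrow> 'a) \<Rightarrow> 'v \<Rightarrow> 'a" where
  "twist s C f v = (if v \<in> C then conj_by G s (f v) else f v)"

lemma (in group) braid_family_twist:
  assumes f: "braid_family G E lab f" and s: "s \<in> carrier G"
    and sym: "\<And>u v. E u v \<Longrightarrow> E v u \<and> lab v u = lab u v"
    and mixed: "\<And>u v. E u v \<Longrightarrow> u \<in> C \<Longrightarrow> v \<notin> C \<Longrightarrow> braid_rel G (lab u v) (conj_by G s (f u)) (f v)"
  shows "braid_family G E lab (twist s C f)"
  unfolding braid_family_def
proof (intro conjI allI impI)
  note fG = braid_familyD(1)[OF f]
  show "twist s C f v \<in> carrier G" for v
    using fG[of v] s by (simp add: twist_def)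
  show "braid_rel G (lab u v) (twist s C f u) (twist s C f v)" if e: "E u v" for u v
  proof -
    consider (inside) "u \<in> C" "v \<in> C" | (outside) "u \<notin> C" "v \<notin> C"
      | (leaving) "u \<in> C" "v \<notin> C" | (entering) "u \<notin> C" "v \<in> C"
      by blast
    then show ?thesis
    proof cases
      case inside
      then show ?thesis
        using braid_rel_conj[OF s fG fG braid_familyD(2)[OF f e]] by (simp add: twist_def)
    next
      case outside
      then show ?thesis
        using braid_familyD(2)[OF f e] by (simp add: twist_def)
    next
      case leaving
      then show ?thesis
        using mixed[OF e] by (simp add: twist_def)
    next
      case entering
      then show ?thesis
        using mixed[of v u] sym[OF e] by (simp add: twist_def braid_rel_sym)
    qed
  qed
qed

lemma (in group_character) alt_prod_bundle_map:
  fixes \<rho> \<rho>' :: "'c \<Rightarrow> 'c"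
  assumes "x \<in> carrier G" "y \<in> carrier G" "bij \<rho>" "bij \<rho>'"
  shows "alt_prod bij_group (bundle_map (\<chi> x) \<rho>) (bundle_map (\<chi> y) \<rho>') n
    = bundle_map (\<chi> (alt_prod G x y n)) (alt_prod bij_group \<rho> \<rho>' n)"
  using assms
proof (induction n arbitrary: x y \<rho> \<rho>')
  case 0
  show ?case
    by (auto simp: bij_group_simps char_one fun_eq_iff)
next
  case (Suc n)
  interpret B: group "bij_group :: ('c \<Rightarrow> 'c) monoid"
    by (rule group_BijGroup)
  have bij: "bij (alt_prod bij_group \<rho>' \<rho> n)"
    using B.alt_prod_closed[of \<rho>' \<rho> n] Suc.prems by (simp add: bij_group_simps)
  have "alt_prod bij_group (bundle_map (\<chi> x) \<rho>) (bundle_map (\<chi> y) \<rho>') (Suc n)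
      = bundle_map (\<chi> x) \<rho> \<circ> bundle_map (\<chi> (alt_prod G y x n)) (alt_prod bij_group \<rho>' \<rho> n)"
    using Suc bij by (simp add: bij_group_simps bij_bundle_map)
  also have "\<dots> = bundle_map (\<chi> x + \<chi> (alt_prod G y x n)) (\<rho> \<circ> alt_prod bij_group \<rho>' \<rho> n)"
    by (rule bundle_map_comp)
  also have "\<rho> \<circ> alt_prod bij_group \<rho>' \<rho> n = alt_prod bij_group \<rho> \<rho>' (Suc n)"
    using Suc.prems bij by (simp add: bij_group_simps)
  finally show ?case
    using Suc.prems by (simp add: char_mult)
qed

context artin_character
begin

lemma braid_family_bundle_map:
  assumes R: "braid_family bij_group E lab R"
  shows "braid_family bij_group E lab (\<lambda>v. bundle_map (ht v) (R v))"
proof -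
  have bij: "bij (R v)" for v
    using braid_familyD(1)[OF R, of v] by (simp add: bij_group_simps)
  have "braid_rel bij_group (lab u v) (bundle_map (ht u) (R u)) (bundle_map (ht v) (R v))"
    if e: "E u v" for u v
    using braid_familyD(2)[OF R e] braid_rel_gen[OF e] gen_edge_carrier[OF e]
    by (simp add: braid_rel_def alt_prod_bundle_map bij)
  then show ?thesis
    by (simp add: braid_family_def bij_group_simps bij_bundle_map bij)
qed

definition gauge_compatible :: "('a \<Rightarrow> 'a) \<Rightarrow> 'v set \<Rightarrow> ('v \<Rightarrow> 'a \<Rightarrow> 'a) \<Rightarrow> bool" where
  "gauge_compatible \<tau> C R \<longleftrightarrow> (\<forall>u v. E u v \<and> u \<in> C \<and> v \<notin> C \<longrightarrow>
    braid_rel bij_group (lab u v)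
      (conj_by bij_group (gauge \<tau>) (bundle_map (ht u) (R u))) (bundle_map (ht v) (R v)))"

lemma ex_twisted_action:
  fixes R :: "'v \<Rightarrow> 'a \<Rightarrow> 'a"
  assumes R: "braid_family bij_group E lab R" and \<tau>: "bij \<tau>"
    and compatible: "gauge_compatible \<tau> C R"
  obtains \<phi> where "\<phi> \<in> hom G bij_group"
    "\<And>v p. v \<in> C \<Longrightarrow> \<phi> (gen v) (gauge \<tau> p) = gauge \<tau> (bundle_map (ht v) (R v) p)"
    "\<And>v. v \<notin> C \<Longrightarrow> \<phi> (gen v) = bundle_map (ht v) (R v)"
proof -
  interpret B: group "bij_group :: (real \<times> 'a \<Rightarrow> real \<times> 'a) monoid"
    by (rule group_BijGroup)
  let ?f = "\<lambda>v. bundle_map (ht v) (R v)"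
  have bij: "bij (?f v)" for v
    using braid_familyD(1)[OF R, of v] by (simp add: bij_group_simps bij_bundle_map)
  have "braid_family bij_group E lab (B.twist (gauge \<tau>) C ?f)"
    using \<tau> edgeD(4,5)
    by (intro B.braid_family_twist braid_family_bundle_map R
        compatible[unfolded gauge_compatible_def, rule_format])
      (simp_all add: bij_group_simps bij_gauge)
  then obtain \<phi> where \<phi>: "\<phi> \<in> hom G bij_group" "\<And>v. \<phi> (gen v) = B.twist (gauge \<tau>) C ?f v"
    using B.artin_group_universal by blast
  show ?thesis
    using \<tau> bij by (intro that[OF \<phi>(1)])
      (simp_all add: \<phi>(2) B.twist_def conj_bij_group_apply bij_gauge)
qed

text \<open>A gauge transformation changes the zero section only over \<open>0\<close>, hence not far to the left.\<close>
lemma Sigma1_imp_twisted_gen_preserves: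
  fixes R :: "'v \<Rightarrow> 'a \<Rightarrow> 'a" and z :: 'a
  assumes \<Sigma>: "in_Sigma1 G \<chi>"
    and R: "braid_family bij_group E lab R" "\<And>v. R v z = z" and \<tau>: "bij \<tau>"
    and compatible: "gauge_compatible \<tau> C R"
    and b: "live b" "b \<notin> C" and a: "a \<in> V" "a \<in> C"
    and p: "gauge \<tau> p = (r, z)"
  shows "gauge \<tau> (bundle_map (ht a) (R a) p) = (r + ht a, z)"
proof -
  obtain \<phi> where hom: "\<phi> \<in> hom G bij_group"
    and in_C: "\<And>v p. v \<in> C \<Longrightarrow> \<phi> (gen v) (gauge \<tau> p) = gauge \<tau> (bundle_map (ht v) (R v) p)"
    and out_C: "\<And>v. v \<notin> C \<Longrightarrow> \<phi> (gen v) = bundle_map (ht v) (R v)"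
    using ex_twisted_action[OF R(1) \<tau> compatible] by blast
  interpret section_action G \<chi> \<phi> "\<lambda>r. (r, z)"
    by (intro section_action.intro group_character_axioms group_action.intro group_hom.intro
        group_hom_axioms.intro is_group group_BijGroup hom)
  have gen_low: "preserves_below (min 0 (ht v)) (gen v)" for v
  proof -
    have "\<phi> (gen v) (r, z) = (r + ht v, z)" if "r + ht v < 0" "r < 0" for r
      using in_C[of v "(r, z)"] out_C[of v] that R(2) by (cases "v \<in> C") auto
    then show ?thesis
      by (simp add: preserves_below_def)
  qed
  have low: "\<exists>B. preserves_below B g" if "g \<in> carrier G" for g
    by (rule ex_preserves_below_if_generators[OF _ artin_group_generated _ that])
      (use gen_low in auto)
  have "preserves (gen b)"
    using b(2) by (simp add: preserves_def out_C R(2))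
  then have "preserves (gen a)"
    using Sigma1_imp_preserves[OF \<Sigma> low gen_carrier] liveD[OF b(1)] a(1) by simp
  then show ?thesis
    using in_C[OF a(2), of p] by (simp add: preserves_def p)
qed

end

section \<open>Necessity of connectedness\<close>

lemma (in group) conj_by_pow:
  assumes "s \<in> carrier G" "t \<in> carrier G"
  shows "conj_by G t s [^] (n::nat) = conj_by G t (s [^] n)"
  using assms by (induction n) (simp_all add: conj_by_mult)

lemma (in group) commutator_pow_eq_one:
  assumes s: "s \<in> carrier G" "s [^] (k::nat) = \<one>" and t: "t \<in> carrier G"
    and comm: "s \<otimes> conj_by G t s = conj_by G t s \<otimes> s"
  shows "(s \<otimes> t \<otimes> inv s \<otimes> inv t) [^] k = \<one>"
proof -
  let ?x = "conj_by G t s"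
  have x: "?x \<in> carrier G"
    using s t by simp
  have "s \<otimes> t \<otimes> inv s \<otimes> inv t = s \<otimes> inv ?x"
    using s t by (simp add: inv_mult_group m_assoc)
  also have "\<dots> [^] k = s [^] k \<otimes> inv (?x [^] k)"
    using s x by (simp add: pow_mult_distrib[OF commutes_inv[OF comm s(1) x]] nat_pow_inv)
  also have "\<dots> = \<one>"
    using s t by (simp add: conj_by_pow)
  finally show ?thesis .
qed

lemma ex_root_of_unity_rotation:
  assumes "1 < (p::nat)"
  obtains \<tau> :: "complex \<Rightarrow> complex" where "bij \<tau>" "\<tau> ^^ p = id" "\<tau> 1 \<noteq> 1"
proof -
  have "card {z::complex. z ^ p = 1} = p"
    using assms by (intro card_roots_unity_eq) simp
  then have "\<not> {z::complex. z ^ p = 1} \<subseteq> {1}"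
    using card_mono[of "{1::complex}" "{z. z ^ p = 1}"] assms by auto
  then obtain \<zeta> :: complex where \<zeta>: "\<zeta> ^ p = 1" "\<zeta> \<noteq> 1"
    by blast
  then have "\<zeta> \<noteq> 0"
    using assms by (auto simp: power_0_left)
  then have "bij (\<lambda>x. \<zeta> * x)"
    by (intro o_bij[of "\<lambda>x. x / \<zeta>"]) (auto simp: fun_eq_iff)
  moreover have "((\<lambda>x. \<zeta> * x) ^^ n) = (\<lambda>x. \<zeta> ^ n * x)" for n
    by (induction n) (auto simp: fun_eq_iff)
  ultimately show ?thesis
    using \<zeta> by (intro that[of "\<lambda>x. \<zeta> * x"]) (auto simp: fun_eq_iff)
qed

lemma gauge_commutes_translate:
  assumes "c \<noteq> 0"
  shows "gauge \<tau> \<circ> (bundle_map c id \<circ> gauge \<tau> \<circ> bundle_map (- c) id)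
    = bundle_map c id \<circ> gauge \<tau> \<circ> bundle_map (- c) id \<circ> gauge \<tau>"
  using assms by (auto simp: fun_eq_iff)

lemma inv_translate: "inv\<^bsub>bij_group\<^esub> bundle_map c id = bundle_map (- c) id"
  by (rule group.inv_equality[OF group_BijGroup])
    (simp_all add: bij_group_simps bij_bundle_map bundle_map_comp bundle_map_id)

text \<open>A gauge transformation and its translate have disjoint supports, hence commute.\<close>
lemma braid_rel_gauge_translate:
  assumes \<tau>: "bij \<tau>" "\<tau> ^^ k = id" and c: "c \<noteq> 0"
  shows "braid_rel bij_group (2 * k)
    (conj_by bij_group (gauge \<tau>) (bundle_map c id)) (bundle_map (- c) id)"
proof -
  interpret B: group "bij_group :: (real \<times> 'a \<Rightarrow> real \<times> 'a) monoid"
    by (rule group_BijGroup)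
  have bij: "bij (gauge \<tau>)" "bij (bundle_map c (id :: 'a \<Rightarrow> 'a))" for c
    using \<tau> by (simp_all add: bij_gauge bij_bundle_map)
  have in_group: "gauge \<tau> \<in> carrier bij_group"
    "bundle_map c (id :: 'a \<Rightarrow> 'a) \<in> carrier bij_group"
    using bij by (simp_all add: bij_group_simps)
  have "gauge \<tau> [^]\<^bsub>bij_group\<^esub> k = \<one>\<^bsub>bij_group\<^esub>"
    by (simp add: nat_pow_bij_group bij gauge_funpow \<tau> gauge_id bij_group_simps)
  moreover have "gauge \<tau> \<otimes>\<^bsub>bij_group\<^esub> conj_by bij_group (bundle_map c id) (gauge \<tau>)
      = conj_by bij_group (bundle_map c id) (gauge \<tau>) \<otimes>\<^bsub>bij_group\<^esub> gauge \<tau>"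
    using gauge_commutes_translate[OF c, of \<tau>]
    by (simp add: inv_translate bij_group_simps bij bij_comp)
  ultimately show ?thesis
    using B.commutator_pow_eq_one[OF in_group(1) _ in_group(2), of k] in_group
    by (intro B.braid_rel_if_pow_eq_one) (simp_all flip: inv_translate)
qed

context artin_character
begin

definition live_component :: "'v \<Rightarrow> 'v set" where
  "live_component a = {v. (live_edge V E lab \<chi>)\<^sup>*\<^sup>* a v}"

lemma live_component_boundary:
  assumes a: "live a" and e: "E u v" and u: "u \<in> live_component a" and v: "v \<notin> live_component a"
  shows "live u" "even (lab u v)" "ht v = 0 \<or> dead_edge E lab \<chi> u v"
proof -
  have "(live_edge V E lab \<chi>)\<^sup>*\<^sup>* a u"
    using u by (simp add: live_component_def)
  then show live_u: "live u"
    by (induction rule: rtranclp_induct) (auto simp: a live_edge_def)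
  have "\<not> live_edge V E lab \<chi> u v"
    using u v by (auto simp: live_component_def dest: rtranclp.rtrancl_into_rtrancl)
  then show dead: "ht v = 0 \<or> dead_edge E lab \<chi> u v"
    using live_u e edgeD[OF e] by (auto simp: live_edge_def live_vertex_def)
  then show "even (lab u v)"
    using odd_edge_ht[OF e] liveD(2)[OF live_u]
    by (cases "even (lab u v)") (auto simp: dead_edge_def)
qed

lemma gauge_compatible_live_component:
  assumes p_dvd: "\<And>u v. E u v \<Longrightarrow> even (lab u v) \<Longrightarrow> 2 < lab u v \<Longrightarrow> p dvd lab u v div 2"
    and \<tau>: "bij \<tau>" "\<tau> ^^ p = id"
    and a: "live a"
  shows "gauge_compatible \<tau> (live_component a) (\<lambda>_. id)"
  unfolding gauge_compatible_def
proof (intro allI impI, elim conjE)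
  fix u v assume e: "E u v" and u: "u \<in> live_component a" and v: "v \<notin> live_component a"
  note boundary = live_component_boundary[OF a e u v]
  obtain k where k: "lab u v = 2 * k"
    using boundary(2) by blast
  show "braid_rel bij_group (lab u v)
      (conj_by bij_group (gauge \<tau>) (bundle_map (ht u) id)) (bundle_map (ht v) id)"
  proof (cases "ht v = 0")
    case True
    interpret B: group "bij_group :: (real \<times> 'a \<Rightarrow> real \<times> 'a) monoid"
      by (rule group_BijGroup)
    have "conj_by bij_group (gauge \<tau>) (bundle_map (ht u) id) \<in> carrier bij_group"
      using \<tau>(1) by (intro B.m_closed B.inv_closed)
        (simp_all add: bij_group_simps bij_gauge bij_bundle_map)
    then show ?thesis
      using B.braid_rel_one_even by (simp add: k True bundle_map_id bij_group_simps)
  next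
    case False
    then have ht_v: "ht v = - ht u" and "p dvd k"
      using boundary(3) p_dvd[OF e] k by (auto simp: dead_edge_def)
    then obtain j where "k = p * j"
      by blast
    then have "\<tau> ^^ k = id"
      by (simp add: funpow_mult[symmetric] \<tau>(2) id_funpow)
    then show ?thesis
      unfolding k ht_v using \<tau>(1) liveD(2)[OF boundary(1)] by (intro braid_rel_gauge_translate)
  qed
qed

lemma in_Sigma1_imp_live_path:
  assumes \<Sigma>: "in_Sigma1 G \<chi>" and p: "1 < (p::nat)"
    and p_dvd: "\<And>u v. E u v \<Longrightarrow> even (lab u v) \<Longrightarrow> 2 < lab u v \<Longrightarrow> p dvd lab u v div 2"
    and a: "live a" and b: "live b"
  shows "(live_edge V E lab \<chi>)\<^sup>*\<^sup>* a b"
proof (rule ccontr)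
  assume "\<not> (live_edge V E lab \<chi>)\<^sup>*\<^sup>* a b"
  then have b_notin: "b \<notin> live_component a" and a_in: "a \<in> live_component a"
    by (auto simp: live_component_def)
  obtain \<tau> :: "complex \<Rightarrow> complex" where \<tau>: "bij \<tau>" "\<tau> ^^ p = id" "\<tau> 1 \<noteq> 1"
    using ex_root_of_unity_rotation[OF p] .
  have trivial: "braid_family bij_group E lab (\<lambda>_. id :: complex \<Rightarrow> complex)"
    by (simp add: braid_family_def braid_rel_def bij_group_simps)
  have "gauge \<tau> (bundle_map (ht a) id (- ht a, 1)) = (- ht a + ht a, 1)"
    using liveD[OF a] a_in
    by (intro Sigma1_imp_twisted_gen_preserves[where R = "\<lambda>_. id", OF \<Sigma> trivial _ \<tau>(1)
          gauge_compatible_live_component[OF p_dvd \<tau>(1,2) a] b b_notin]) auto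
  then show False
    using \<tau>(3) by simp
qed

end

section \<open>Necessity of dominance\<close>

definition reflection :: "('v \<Rightarrow> 'v \<Rightarrow> real) \<Rightarrow> 'v \<Rightarrow> ('v \<Rightarrow> real) \<Rightarrow> 'v \<Rightarrow> real" where
  "reflection A v x = (\<lambda>y. x y - A v y * x v)"

lemma bij_reflection:
  assumes "A v v = 2"
  shows "bij (reflection A v)"
proof (rule o_bij)
  show "reflection A v \<circ> reflection A v = id"
    using assms by (auto simp: reflection_def fun_eq_iff algebra_simps)
  then show "reflection A v \<circ> reflection A v = id" .
qed

text \<open>The coefficients with which an alternating product of two reflections moves a vector; they
  are partial sums of Chebyshev polynomials of the second kind.\<close>
fun alt_coeff :: "real \<Rightarrow> nat \<Rightarrow> real \<Rightarrow> real \<Rightarrow> real" where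
  "alt_coeff c 0 x y = 0"
| "alt_coeff c (Suc 0) x y = x"
| "alt_coeff c (Suc (Suc n)) x y = x + 2 * c * alt_coeff c (Suc n) y x - alt_coeff c n x y"

lemma alt_coeff_Suc_diff:
  "(alt_coeff (cos \<theta>) (Suc n) x y - alt_coeff (cos \<theta>) n x y) * sin \<theta>
    = (if even n then x else y) * sin (real (Suc n) * \<theta>)"
proof (induction n arbitrary: x y rule: induct_nat_012)
  case 0
  show ?case by simp
next
  case 1
  show ?case by (simp add: sin_double)
next
  case (ge2 n)
  let ?d = "\<lambda>n x y. (alt_coeff (cos \<theta>) (Suc n) x y - alt_coeff (cos \<theta>) n x y) * sin \<theta>"
  let ?m = "real (Suc (Suc n)) * \<theta>"
  have angles: "real (Suc (Suc (Suc n))) * \<theta> = ?m + \<theta>" "real (Suc n) * \<theta> = ?m - \<theta>"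
    by (auto simp: algebra_simps)
  have "?d (Suc (Suc n)) x y = 2 * cos \<theta> * ?d (Suc n) y x - ?d n x y"
    by (simp add: algebra_simps)
  also have "\<dots> = (if even n then x else y) * (2 * cos \<theta> * sin ?m - sin (real (Suc n) * \<theta>))"
    using ge2 by (simp add: algebra_simps)
  also have "2 * cos \<theta> * sin ?m - sin (real (Suc n) * \<theta>) = sin (real (Suc (Suc (Suc n))) * \<theta>)"
    unfolding angles sin_add sin_diff by (simp add: algebra_simps)
  finally show ?case by simp
qed

lemma alt_prod_reflection:
  assumes "A u u = 2" "A v v = 2" "A u v = - 2 * c" "A v u = - 2 * c"
  shows "alt_prod bij_group (reflection A u) (reflection A v) (Suc n) x
    = (\<lambda>y. x y - A u y * alt_coeff c (Suc n) (x u) (x v) - A v y * alt_coeff c n (x v) (x u))"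
  using assms
proof (induction n arbitrary: u v)
  case 0
  then show ?case
    by (simp add: bij_group_simps bij_reflection) (simp add: reflection_def)
next
  case (Suc n)
  interpret B: group "bij_group :: (('a \<Rightarrow> real) \<Rightarrow> 'a \<Rightarrow> real) monoid"
    by (rule group_BijGroup)
  have bij: "bij (alt_prod bij_group (reflection A v) (reflection A u) (Suc n))"
    using B.alt_prod_closed[of "reflection A v" "reflection A u" "Suc n"] Suc.prems
    by (simp add: bij_group_simps(1) bij_reflection)
  have "alt_prod bij_group (reflection A u) (reflection A v) (Suc (Suc n)) x
      = reflection A u (alt_prod bij_group (reflection A v) (reflection A u) (Suc n) x)"
    unfolding alt_prod.simps(2)[of _ _ _ "Suc n"]
    using Suc.prems(1) bij by (simp only: bij_group_simps bij_reflection o_apply)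
  also have "\<dots> = (\<lambda>y. x y - A u y * alt_coeff c (Suc (Suc n)) (x u) (x v)
      - A v y * alt_coeff c (Suc n) (x v) (x u))"
    unfolding Suc.IH[OF Suc.prems(2,1,4,3)] using Suc.prems
    by (simp add: reflection_def algebra_simps)
  finally show ?case .
qed

lemma braid_rel_reflection:
  assumes A: "A u u = 2" "A v v = 2"
      "A u v = - 2 * cos (pi / real m)" "A v u = - 2 * cos (pi / real m)"
    and m: "2 \<le> m"
  shows "braid_rel bij_group m (reflection A u) (reflection A v)"
proof -
  obtain k where k: "m = Suc k"
    using m by (cases m) auto
  define c where "c = cos (pi / real m)"
  have "0 < sin (pi / real m)"
    using m by (intro sin_gt_zero) (auto simp: field_simps)
  then have eq: "alt_coeff c (Suc k) x y = alt_coeff c k x y" for x y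
    using alt_coeff_Suc_diff[of "pi / real m" k x y] m by (simp add: c_def k)
  have uv: "A u v = - 2 * c" "A v u = - 2 * c"
    using A by (simp_all add: c_def)
  show ?thesis
    unfolding braid_rel_def k fun_eq_iff alt_prod_reflection[OF A(1,2) uv]
      alt_prod_reflection[OF A(2,1) uv(2,1)] eq
    by simp
qed

definition coxeter_form :: "('v \<Rightarrow> 'v \<Rightarrow> bool) \<Rightarrow> ('v \<Rightarrow> 'v \<Rightarrow> nat) \<Rightarrow> 'v \<Rightarrow> 'v \<Rightarrow> real" where
  "coxeter_form E lab u v =
    (if u = v then 2 else if E u v then - 2 * cos (pi / real (lab u v)) else 0)"

lemma (in artin_character) braid_family_reflection:
  "braid_family bij_group E lab (reflection (coxeter_form E lab))"
  unfolding braid_family_def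
proof (intro conjI allI impI)
  show "reflection (coxeter_form E lab) v \<in> carrier bij_group" for v
    by (simp add: bij_group_simps bij_reflection coxeter_form_def)
  show "braid_rel bij_group (lab u v)
      (reflection (coxeter_form E lab) u) (reflection (coxeter_form E lab) v)"
    if e: "E u v" for u v
    using edgeD[OF e] e by (intro braid_rel_reflection) (auto simp: coxeter_form_def)
qed

lemma (in group) conj_by_eq_if_commutes:
  assumes "s \<in> carrier G" "x \<in> carrier G" "s \<otimes> x = x \<otimes> s"
  shows "conj_by G s x = x"
  using assms by (simp add: m_assoc)

context artin_character
begin

lemma braid_rel_gauge_commuting:
  fixes R :: "'v \<Rightarrow> 'a \<Rightarrow> 'a"
  assumes R: "braid_family bij_group E lab R" and \<tau>: "bij \<tau>"
    and e: "E u v" and v: "ht v = 0" "\<tau> \<circ> R v = R v \<circ> \<tau>"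
  shows "braid_rel bij_group (lab u v)
    (conj_by bij_group (gauge \<tau>) (bundle_map (ht u) (R u))) (bundle_map (ht v) (R v))"
proof -
  interpret B: group "bij_group :: (real \<times> 'a \<Rightarrow> real \<times> 'a) monoid"
    by (rule group_BijGroup)
  note family = braid_familyD[OF braid_family_bundle_map[OF R]]
  have s: "gauge \<tau> \<in> carrier bij_group"
    using \<tau> by (simp add: bij_group_simps bij_gauge)
  have "gauge \<tau> \<circ> bundle_map (ht v) (R v) = bundle_map (ht v) (R v) \<circ> gauge \<tau>"
    using v by (auto simp: fun_eq_iff)
  then have "gauge \<tau> \<otimes>\<^bsub>bij_group\<^esub> bundle_map (ht v) (R v)
      = bundle_map (ht v) (R v) \<otimes>\<^bsub>bij_group\<^esub> gauge \<tau>"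
    using s family(1)[of v] by (simp add: bij_group_simps)
  then have "conj_by bij_group (gauge \<tau>) (bundle_map (ht v) (R v)) = bundle_map (ht v) (R v)"
    by (rule B.conj_by_eq_if_commutes[OF s family(1)])
  then show ?thesis
    using B.braid_rel_conj[OF s family(1) family(1) family(2)[OF e]] by simp
qed

lemma in_Sigma1_imp_liv_dominant:
  assumes \<Sigma>: "in_Sigma1 G \<chi>" and b: "live b"
  shows "liv_dominant V E lab \<chi>"
  unfolding liv_dominant_def
proof (intro ballI impI, rule ccontr)
  fix d assume dV: "d \<in> V" and d: "\<not> live d" and no_live_nbr: "\<not> (\<exists>u. live u \<and> E d u)"
  have ht_d: "ht d = 0"
    using d dV by (simp add: live_vertex_def)
  have ht_nbr: "ht u = 0" if "E d u" for u
    using no_live_nbr that edgeD[OF that] by (auto simp: live_vertex_def)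
  define R where "R = reflection (coxeter_form E lab)"
  have R: "braid_family bij_group E lab R"
    unfolding R_def by (rule braid_family_reflection)
  define \<tau> :: "('v \<Rightarrow> real) \<Rightarrow> 'v \<Rightarrow> real" where "\<tau> = (\<lambda>x. x(d := x d + 1))"
  have \<tau>: "bij \<tau>"
    by (rule o_bij[of "\<lambda>x. x(d := x d - 1)"]) (auto simp: \<tau>_def fun_eq_iff)
  have "\<tau> \<circ> R v = R v \<circ> \<tau>" if "v \<noteq> d" for v
    using that by (auto simp: fun_eq_iff \<tau>_def R_def reflection_def)
  then have compatible: "gauge_compatible \<tau> {d} R"
    unfolding gauge_compatible_def using ht_nbr
    by (intro allI impI braid_rel_gauge_commuting R \<tau>) auto
  have "gauge \<tau> (bundle_map (ht d) (R d) (0, (\<lambda>_. 0)(d := - 1))) = (0 + ht d, \<lambda>_. 0)"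
    using b d dV
    by (intro Sigma1_imp_twisted_gen_preserves[where C = "{d}", OF \<Sigma> R _ \<tau> compatible b])
      (auto simp: R_def reflection_def \<tau>_def)
  from fun_cong[OF arg_cong[OF this, of snd], of d] show False
    by (simp add: ht_d \<tau>_def R_def reflection_def coxeter_form_def)
qed

end

section \<open>The main theorem\<close>

lemma (in artin_character) ex_live_vertex:
  assumes "g \<in> carrier G" "\<chi> g \<noteq> 0"
  shows "\<exists>v. live v"
proof (rule ccontr)
  assume "\<not> ?thesis"
  then have "ht v = 0" if "v \<in> V" for v
    using that by (auto simp: live_vertex_def)
  then have "\<chi> g = 0"
    by (intro char_eq_0_if_generators[OF _ artin_group_generated _ assms(1)]) auto
  with assms(2) show False
    by simp
qed

theorem theorem1p3:
  fixes V :: "'v set" and E :: "'v \<Rightarrow> 'v \<Rightarrow> bool" and lab :: "'v \<Rightarrow> 'v \<Rightarrow> nat"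
    and \<chi> :: "('v \<times> bool) list set \<Rightarrow> real"
  assumes "labelled_graph V E lab"
    and "\<exists>p::nat. prime p \<and> (\<forall>u v. E u v \<and> even (lab u v) \<and> lab u v > 2 \<longrightarrow> p dvd (lab u v div 2))"
    and "character (artin_group V E lab) \<chi>"
    and "\<exists>g\<in>carrier (artin_group V E lab). \<chi> g \<noteq> 0"
  shows "in_Sigma1 (artin_group V E lab) \<chi> \<longleftrightarrow>
           liv_connected V E lab \<chi> \<and> liv_dominant V E lab \<chi>"
proof
  interpret artin_character V E lab \<chi>
    using assms by unfold_locales
  show "in_Sigma1 G \<chi>" if "liv_connected V E lab \<chi> \<and> liv_dominant V E lab \<chi>"
    using that in_Sigma1_if_liv_connected_dominant by blast
  assume \<Sigma>: "in_Sigma1 G \<chi>"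
  obtain p :: nat where "prime p"
    and p_dvd: "\<And>u v. E u v \<Longrightarrow> even (lab u v) \<Longrightarrow> 2 < lab u v \<Longrightarrow> p dvd lab u v div 2"
    using assms(2) by blast
  then have "liv_connected V E lab \<chi>"
    using in_Sigma1_imp_live_path[OF \<Sigma> prime_gt_1_nat p_dvd] ex_live_vertex assms(4)
    by (auto simp: liv_connected_def)
  moreover have "liv_dominant V E lab \<chi>"
    using in_Sigma1_imp_liv_dominant[OF \<Sigma>] ex_live_vertex assms(4) by blast
  ultimately show "liv_connected V E lab \<chi> \<and> liv_dominant V E lab \<chi>" ..
qed

end
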